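(* Let $\alpha > 0$ be a real number. For integers $k\geq 1$ define $$ a_k = {}_1F_2\left(\frac{1+\alpha}{2};\, \frac32,\, \frac{3+\alpha}{2};\, -\frac{\pi^2}{16}(2k-1)^2\right).$$ Suppose that $a_k \geq 0$ for all odd $k\ge 1$ and $a_k\leq 0$ for all even $k \ge 1$. Then: (i) For all smooth, even functions $f:[-1/2,1/2]\rightarrow\mathbb{R}$, $$ \max(\widehat{f}) \geq \frac{\alpha+1}{\alpha\pi}\int_{-1/2}^{1/2}\left(1-|2x|^{\alpha}\right) f(x)\,dx,$$ where $$ \max(\widehat{f}) = \max\left\{ \sup_{k \in \mathbb{Z}_{\geq 0}} \left(2k+\tfrac12\right)\widehat{f}\left(2k+\tfrac12\right),\; -\inf_{k\in\mathbb{Z}_{\geq 0}} \left(2k+\tfrac32\right)\widehat{f}\left(2k+\tfrac32\right)\right\}.$$ (ii) The characteristic function $u=\chi_{[-1/2,1/2]}$ is a local minimizer, among smooth functions supported in $[-1/2,1/2]$, of the functional $$ J_\alpha(v) = \frac{\| \xi \cdot \widehat{v}(\xi)\|_{L^\infty(\mathbb{R})}^{\alpha} \cdot \| |x|^{\alpha} \cdot v\|_{L^1(\mathbb{R})}}{\|v\|_{L^1(\mathbb{R})}^{\alpha+1}},$$ in the following sense: for every smooth function $f:[-1/2,1/2]\to\mathbb{R}$ (extended by $0$ to $\mathbb{R}$) there exists $\varepsilon_0>0$ such that $J_\alpha(u+\varepsilon f)\geq J_\alpha(u)$ for all $0<\varepsilon<\varepsilon_0$.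
   Context: The Fourier transform is $\widehat{v}(\xi) = \int_{\mathbb{R}} v(x) e^{-2\pi i \xi x}\,dx$. A function on $[-1/2,1/2]$ is called smooth if it is $C^\infty$ up to the endpoints of the closed interval (it need not vanish at the endpoints); it is regarded as a function on $\mathbb{R}$ by extending it by $0$. The functional $J_\alpha$ is defined for nonzero $v\in L^1(\mathbb{R})$, with values in $[0,\infty]$. The generalized hypergeometric function is ${}_1F_2(a;b,c;z) = \sum_{m=0}^\infty \frac{(a)_m}{(b)_m (c)_m}\frac{z^m}{m!}$, where $(a)_m = a(a+1)\cdots(a+m-1)$ and $(a)_0=1$. *)

theory Defs
  imports "HOL-Analysis.Analysis" "HOL-Probability.Essential_Supremum"
begin

definition hypergeom_1F2 :: "real \<Rightarrow> real \<Rightarrow> real \<Rightarrow> real \<Rightarrow> real" where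
  "hypergeom_1F2 a b c z =
     (\<Sum>m. pochhammer a m / (pochhammer b m * pochhammer c m) * (z ^ m / fact m))"

definition coeff_a :: "real \<Rightarrow> nat \<Rightarrow> real" where
  "coeff_a \<alpha> k =
     hypergeom_1F2 ((1 + \<alpha>) / 2) (3 / 2) ((3 + \<alpha>) / 2) (- (pi\<^sup>2 / 16) * (2 * real k - 1)\<^sup>2)"

text \<open>Smoothness up to the boundary: \<open>D n\<close> is the \<open>n\<close>-th derivative of \<open>f\<close> on \<open>S\<close>; at an
  endpoint of a closed interval \<open>S\<close> the derivative within \<open>S\<close> is the one-sided derivative.\<close>

definition smooth_within :: "real set \<Rightarrow> (real \<Rightarrow> real) \<Rightarrow> bool" where
  "smooth_within S f \<longleftrightarrow>
     (\<exists>D :: nat \<Rightarrow> real \<Rightarrow> real.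
        (\<forall>x\<in>S. D 0 x = f x) \<and>
        (\<forall>n. \<forall>x\<in>S. (D n has_real_derivative D (Suc n) x) (at x within S)))"

text \<open>A function on $[-1/2,1/2]$ is represented by a function on the whole real line whose values
  outside the interval are irrelevant; this is its extension by zero.\<close>

definition zero_ext :: "(real \<Rightarrow> real) \<Rightarrow> real \<Rightarrow> real" where
  "zero_ext f x = (if x \<in> {-1/2..1/2} then f x else 0)"

definition fourier :: "(real \<Rightarrow> real) \<Rightarrow> real \<Rightarrow> complex" where
  "fourier v \<xi> =
     (LINT x|lborel. complex_of_real (v x) * exp (- 2 * complex_of_real pi * \<i> * of_real \<xi> * of_real x))"

text \<open>Used for even real \<open>f\<close>, whose Fourier transform is real-valued, so that \<open>Re\<close> only changes
  the type. The supremum and infimum are taken in the extended reals, because on type \<open>real\<close> they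
  are unspecified for unbounded sets.\<close>

definition max_fourier :: "(real \<Rightarrow> real) \<Rightarrow> ereal" where
  "max_fourier f =
     max (SUP k::nat. ereal ((2 * real k + 1/2) * Re (fourier (zero_ext f) (2 * real k + 1/2))))
         (- (INF k::nat. ereal ((2 * real k + 3/2) * Re (fourier (zero_ext f) (2 * real k + 3/2)))))"

definition L1_norm :: "(real \<Rightarrow> real) \<Rightarrow> ennreal" where
  "L1_norm v = (\<integral>\<^sup>+ x. ennreal \<bar>v x\<bar> \<partial>lborel)"

definition Linf_norm :: "(real \<Rightarrow> complex) \<Rightarrow> ennreal" where
  "Linf_norm g = esssup lborel (\<lambda>\<xi>. ennreal (cmod (g \<xi>)))"

text \<open>Only used with an exponent \<open>p > 0\<close>.\<close>

definition ennreal_powr :: "ennreal \<Rightarrow> real \<Rightarrow> ennreal" where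
  "ennreal_powr t p = (if t = \<infinity> then \<infinity> else ennreal (enn2real t powr p))"

text \<open>Meant for nonzero integrable \<open>v\<close>. If \<open>v = 0\<close> almost everywhere, the formula evaluates to
  \<open>0\<close>, which is below every value at a nonzero function, so the convention cannot make a lower
  bound on \<open>J\<close> hold vacuously.\<close>

definition J :: "real \<Rightarrow> (real \<Rightarrow> real) \<Rightarrow> ennreal" where
  "J \<alpha> v =
     ennreal_powr (Linf_norm (\<lambda>\<xi>. of_real \<xi> * fourier v \<xi>)) \<alpha>
       * L1_norm (\<lambda>x. \<bar>x\<bar> powr \<alpha> * v x)
     / ennreal_powr (L1_norm v) (\<alpha> + 1)"

end

theory Submission
  imports Defs
begin

text \<open>
  Why the theorem holds. On the interval \<open>{-1/2..1/2}\<close> consider the cap \<open>h x = 1 - \<bar>2 * x\<bar> powr \<alpha>\<close>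
  and the modes \<open>e k x = cos ((2 * k + 1) * pi * x)\<close>, which vanish at the endpoints. Pairing a real
  function \<open>f\<close> with \<open>e k\<close> gives the real part of its Fourier transform at the frequency \<open>k + 1/2\<close>.
  Termwise integration of the cosine series (\<open>coeff_a_eq_integral\<close>) shows that the hypergeometric
  numbers are, up to a positive factor, the coefficients of \<open>h\<close>, so the assumption says that these
  coefficients alternate in sign. The modes are complete among even continuous functions that vanish
  at the endpoints (\<open>cos_poly_dense\<close>), which yields a series for the integral of \<open>h * g\<close>, valid for
  every continuous \<open>g\<close> (\<open>parseval_cos_mode\<close>).

  For the constant function \<open>1\<close> the quantities \<open>m k = (-1) ^ k * (k + 1/2) * <f, e k>\<close> all equal
  \<open>1 / pi\<close>. Let \<open>s = (\<alpha> + 1) / \<alpha> * <h, f>\<close>. If every \<open>pi * m k\<close> were less than \<open>s\<close>, then all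
  terms of the series for \<open><h, s - f>\<close> would be nonnegative and some positive, although the
  choice of \<open>s\<close> makes the sum zero. This proves part (i).

  Part (ii) is more delicate. Inserting the bound of part (i) into the functional gives equality to
  first order in \<open>\<epsilon>\<close>, and a second-order term of the wrong sign. The way out is the equality case: unless
  some \<open>pi * m k\<close> exceeds \<open>s\<close>, which gives a strict gain of first order, all terms of the series are
  zero (\<open>mode_dichotomy\<close>). If no coefficient of \<open>h\<close> vanishes, then \<open>s - f\<close> is orthogonal to
  all modes, hence of integral zero, and the comparison becomes an identity in \<open>\<epsilon>\<close>.

  That no coefficient vanishes follows from the sign pattern itself. If \<open>\<alpha> < 2\<close>, the singularity of
  \<open>h\<close> at the origin dominates the coefficients and destroys the alternation
  (\<open>cap_coeff_alternating_imp_ge_2\<close>); if \<open>\<alpha> \<ge> 2\<close>, integration by parts shows that the alternation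
  is strict (\<open>cap_coeff_strictly_alternating\<close>).
\<close>

section \<open>The hypergeometric values as cosine coefficients\<close>

lemma fact_odd_pochhammer: "fact (2 * m + 1) = (4::real) ^ m * fact m * pochhammer (3 / 2) m"
proof (induction m)
  case (Suc m)
  have "fact (2 * Suc m + 1) = (2 * real m + 3) * (2 * real m + 2) * fact (2 * m + 1)"
    by (simp add: algebra_simps)
  also have "\<dots> = (2 * real m + 3) * (2 * real m + 2) * ((4::real) ^ m * fact m * pochhammer (3 / 2) m)"
    using Suc.IH by simp
  also have "\<dots> = 4 ^ Suc m * fact (Suc m) * pochhammer (3 / 2) (Suc m)"
    by (simp add: pochhammer_Suc field_simps)
  finally show ?case .
qed simp

lemma pochhammer_shift_ratio:
  fixes a :: real
  assumes "a > 0"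
  shows "pochhammer a m / pochhammer (a + 1) m = a / (a + real m)"
proof -
  have "a * pochhammer (a + 1) m = pochhammer a m * (a + real m)"
    using pochhammer_rec[of a m] pochhammer_Suc[of a m] by simp
  moreover have "pochhammer (a + 1) m > 0" by (rule pochhammer_pos) (use assms in simp)
  ultimately show ?thesis using assms by (simp add: field_simps)
qed

lemma has_integral_one_minus_powr_times_even_power:
  assumes "\<alpha> > 0"
  shows "((\<lambda>t::real. (1 - t powr \<alpha>) * t ^ (2 * m)) has_integral
           \<alpha> / ((2 * real m + 1) * (2 * real m + 1 + \<alpha>))) {0..1}"
proof -
  have 1: "((\<lambda>t::real. t powr p) has_integral 1 / (p + 1)) {0..1}" if "p \<ge> 0" for p
    using has_integral_powr_from_0[of p 1] that by simp
  have "((\<lambda>t::real. t powr real (2*m)  - t powr (\<alpha> + real (2*m))) has_integral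
      1 / (real (2*m) + 1) - 1 / (\<alpha> + real (2*m) + 1)) {0..1}"
    by (intro has_integral_diff 1) (use assms in auto)
  moreover have "1 / (real (2*m) + 1) - 1 / (\<alpha> + real (2*m) + 1)
      = \<alpha> / ((2 * real m + 1) * (2 * real m + 1 + \<alpha>))"
    using assms by (simp add: field_simps add_pos_nonneg)
  ultimately have 2: "((\<lambda>t::real. t powr real (2*m)  - t powr (\<alpha> + real (2*m))) has_integral
      \<alpha> / ((2 * real m + 1) * (2 * real m + 1 + \<alpha>))) {0..1}" by simp
  show ?thesis
    by (rule has_integral_spike[OF negligible_sing[of 0] _ 2])
       (simp add: powr_add powr_realpow algebra_simps del: of_nat_mult)
qed

text \<open>The power series of the cosine may be integrated term by term against \<open>1 - t powr \<alpha>\<close>, because it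
converges uniformly on the unit interval. The moment
\<open>\<alpha> / ((2 * m + 1) * (2 * m + 1 + \<alpha>))\<close> supplies the quotient of the two Pochhammer symbols that
differ by a shift of one, and its factor \<open>2 * m + 1\<close> turns \<open>fact (2 * m)\<close> into the product of
\<open>fact m\<close> and \<open>pochhammer (3 / 2) m\<close>.\<close>

lemma hypergeom_1F2_eq_integral:
  assumes "\<alpha> > 0"
  shows "hypergeom_1F2 ((1 + \<alpha>) / 2) (3 / 2) ((3 + \<alpha>) / 2) (- (\<omega>\<^sup>2 / 4))
         = (1 + \<alpha>) / \<alpha> * integral {0..1} (\<lambda>t. (1 - t powr \<alpha>) * cos (\<omega> * t))"
proof -
  define T where "T = (\<lambda>m (t::real). (1 - t powr \<alpha>) * ((- 1) ^ m / fact (2 * m) * (\<omega> * t) ^ (2 * m)))"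
  have T_bound: "norm (T m t) \<le> \<bar>\<omega>\<bar> ^ (2 * m) / fact (2 * m)" if "t \<in> {0..1}" for m t
  proof -
    have t: "\<bar>1 - t powr \<alpha>\<bar> \<le> 1" "t ^ (2*m) \<le> 1" "t ^ (2*m) \<ge> 0"
      using that assms powr_le1[of \<alpha> t] by (auto simp: power_le_one)
    have "norm (T m t) = \<bar>1 - t powr \<alpha>\<bar> * t ^ (2*m) * (\<bar>\<omega>\<bar> ^ (2 * m) / fact (2 * m))"
      using that by (simp add: T_def abs_mult power_mult_distrib power_abs)
    also have "\<dots> \<le> 1 * 1 * (\<bar>\<omega>\<bar> ^ (2 * m) / fact (2 * m))"
      using t by (intro mult_right_mono mult_mono) auto
    finally show ?thesis by simp
  qed
  have summ: "summable (\<lambda>m. \<bar>\<omega>\<bar> ^ (2 * m) / fact (2 * m))"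
    using sums_summable[OF cosh_converges[of "\<bar>\<omega>\<bar>"]] summable_mono_reindex
          summable_reindex[OF summable_exp[of "\<bar>\<omega>\<bar>"], of "\<lambda>m. 2 * m"]
    by (simp add: inj_def o_def field_simps)
  have lim: "uniform_limit {0..1} (\<lambda>n t. \<Sum>m<n. T m t) (\<lambda>t. \<Sum>m. T m t) sequentially"
    by (rule Weierstrass_m_test[OF T_bound summ])
  have T_suminf: "(\<Sum>m. T m t) = (1 - t powr \<alpha>) * cos (\<omega> * t)" for t
    unfolding T_def using sums_mult[OF cos_paired[of "\<omega> * t"], of "1 - t powr \<alpha>"]
    by (simp add: sums_iff)
  have T_int: "(T m has_integral \<alpha> / (1 + \<alpha>) *
      (pochhammer ((1 + \<alpha>) / 2) m / (pochhammer (3 / 2) m * pochhammer ((3 + \<alpha>) / 2) m) *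
        ((- (\<omega>\<^sup>2 / 4)) ^ m / fact m))) {0..1}" for m
  proof -
    have r: "pochhammer ((1 + \<alpha>) / 2) m / pochhammer ((3 + \<alpha>) / 2) m = (1 + \<alpha>) / (2 * real m + 1 + \<alpha>)"
    proof -
      have "(1 + \<alpha>) / 2 + 1 = (3 + \<alpha>) / 2" by simp
      moreover have "(1 + \<alpha>) / 2 / ((1 + \<alpha>) / 2 + real m) = (1 + \<alpha>) / (2 * real m + 1 + \<alpha>)"
        using assms by (simp add: divide_simps add_pos_nonneg) (simp add: algebra_simps)
      moreover have "pochhammer ((1 + \<alpha>) / 2) m / pochhammer ((1 + \<alpha>) / 2 + 1) m
          = (1 + \<alpha>) / 2 / ((1 + \<alpha>) / 2 + real m)"
        by (rule pochhammer_shift_ratio) (use assms in simp)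
      ultimately show ?thesis by (simp only:)
    qed
    have pos: "pochhammer (3 / 2 :: real) m > 0" by (rule pochhammer_pos) simp
    have f: "fact (2 * m) * (2 * real m + 1) = (4::real) ^ m * fact m * pochhammer (3 / 2) m"
      using fact_odd_pochhammer[of m] by (simp add: algebra_simps)
    have w: "(- (\<omega>\<^sup>2 / 4)) ^ m = (-1) ^ m * \<omega> ^ (2 * m) / 4 ^ m"
      unfolding power_minus[of "\<omega>\<^sup>2 / 4"] power_divide power_mult by simp
    have "(-1) ^ m / fact (2 * m) * \<omega> ^ (2 * m) * (\<alpha> / ((2 * real m + 1) * (2 * real m + 1 + \<alpha>)))
        = \<alpha> / (2 * real m + 1 + \<alpha>) * ((-1) ^ m * \<omega> ^ (2 * m) / (fact (2 * m) * (2 * real m + 1)))"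
      by (simp add: mult_ac)
    also have "\<dots> = \<alpha> / (1 + \<alpha>) * ((1 + \<alpha>) / (2 * real m + 1 + \<alpha>)) *
        ((-1) ^ m * \<omega> ^ (2 * m) / (4 ^ m * fact m * pochhammer (3 / 2) m))"
      unfolding f using assms by simp
    also have "\<dots> = \<alpha> / (1 + \<alpha>) *
      (pochhammer ((1 + \<alpha>) / 2) m / (pochhammer (3 / 2) m * pochhammer ((3 + \<alpha>) / 2) m) *
        ((- (\<omega>\<^sup>2 / 4)) ^ m / fact m))"
      unfolding r[symmetric] w by (simp add: mult_ac)
    finally have v: "(-1) ^ m / fact (2 * m) * \<omega> ^ (2 * m) * (\<alpha> / ((2 * real m + 1) * (2 * real m + 1 + \<alpha>))) = \<dots>" .
    have T_eq: "T m = (\<lambda>t. (-1) ^ m / fact (2 * m) * \<omega> ^ (2 * m) * ((1 - t powr \<alpha>) * t ^ (2 * m)))"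
      by (simp add: T_def power_mult_distrib fun_eq_iff)
    show ?thesis
      unfolding v[symmetric] T_eq
      by (intro has_integral_mult_right has_integral_one_minus_powr_times_even_power assms)
  qed
  have cont: "continuous_on {0..1} (\<lambda>t. \<Sum>m<n. T m t)" for n
    unfolding T_def using assms by (intro continuous_intros continuous_on_powr') auto
  obtain I K where I: "\<And>n. ((\<lambda>t. \<Sum>m<n. T m t) has_integral I n) {0..1}"
    and K: "((\<lambda>t. \<Sum>m. T m t) has_integral K) {0..1}" and IK: "I \<longlonglongrightarrow> K"
    by (rule uniform_limit_integral[OF lim cont]) auto
  have I_eq: "I = (\<lambda>n. \<Sum>m<n. \<alpha> / (1 + \<alpha>) *
      (pochhammer ((1 + \<alpha>) / 2) m / (pochhammer (3 / 2) m * pochhammer ((3 + \<alpha>) / 2) m) *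
        ((- (\<omega>\<^sup>2 / 4)) ^ m / fact m)))"
    by (rule ext, rule has_integral_unique[OF I has_integral_sum]) (rule finite_lessThan, rule T_int)
  have "(\<lambda>m. \<alpha> / (1 + \<alpha>) *
      (pochhammer ((1 + \<alpha>) / 2) m / (pochhammer (3 / 2) m * pochhammer ((3 + \<alpha>) / 2) m) *
        ((- (\<omega>\<^sup>2 / 4)) ^ m / fact m))) sums K"
    using IK unfolding sums_def I_eq .
  from sums_mult[OF this, of "(1 + \<alpha>) / \<alpha>"]
  have "hypergeom_1F2 ((1 + \<alpha>) / 2) (3 / 2) ((3 + \<alpha>) / 2) (- (\<omega>\<^sup>2 / 4)) = (1 + \<alpha>) / \<alpha> * K"
    using assms unfolding hypergeom_1F2_def by (simp add: sums_iff)
  then show ?thesis using K by (simp add: T_suminf integral_unique)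
qed

text \<open>Up to a positive factor the hypergeometric values are thus the Fourier coefficients of the profile
\<open>1 - t powr \<alpha>\<close> in the cosine system that vanishes at \<open>t = 1\<close>.\<close>

lemma coeff_a_eq_integral:
  assumes "\<alpha> > 0"
  shows "coeff_a \<alpha> (Suc k) = (1 + \<alpha>) / \<alpha> *
           integral {0..1} (\<lambda>t. (1 - t powr \<alpha>) * cos ((2 * real k + 1) * pi / 2 * t))"
proof -
  have "- (pi\<^sup>2 / 16) * (2 * real (Suc k) - 1)\<^sup>2 = - (((2 * real k + 1) * pi / 2)\<^sup>2 / 4)"
    by (simp add: power2_eq_square algebra_simps)
  then show ?thesis
    unfolding coeff_a_def by (simp only: hypergeom_1F2_eq_integral[OF assms])
qed

section \<open>Signs of the cosine coefficients\<close>

text \<open>The exponent \<open>p\<close> may be negative: the zero of \<open>g\<close> at the origin compensates the singularity. The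
value at the origin is right because \<open>0 powr p = 0\<close>.\<close>

lemma continuous_on_powr_mult:
  fixes g :: "real \<Rightarrow> real"
  assumes g: "continuous_on {0..1} g" and le: "\<And>t. t \<in> {0..1} \<Longrightarrow> \<bar>g t\<bar> \<le> C * t ^ n"
    and pos: "p + real n > 0"
  shows "continuous_on {0..1} (\<lambda>t. t powr p * g t)"
  unfolding continuous_on_def
proof
  fix x :: real assume x: "x \<in> {0..1}"
  have gx: "(g \<longlongrightarrow> g x) (at x within {0..1})"
    using g x by (auto simp: continuous_on_def)
  show "((\<lambda>t. t powr p * g t) \<longlongrightarrow> x powr p * g x) (at x within {0..1})"
  proof (cases "x = 0")
    case False
    with gx show ?thesis by (intro tendsto_intros) auto
  next
    case True
    have lim: "((\<lambda>t. C * t powr (p + real n)) \<longlongrightarrow> 0) (at 0 within {0..1})"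
    proof -
      have "((\<lambda>t::real. t powr (p + real n)) \<longlongrightarrow> 0 powr (p + real n)) (at 0 within {0..1})"
        using pos by (intro tendsto_powr' tendsto_intros) (auto simp: eventually_at_filter)
      then show ?thesis by (auto intro: tendsto_eq_intros)
    qed
    have "((\<lambda>t. t powr p * g t) \<longlongrightarrow> 0) (at 0 within {0..1})"
    proof (rule Lim_null_comparison[OF _ lim])
      show "\<forall>\<^sub>F t in at 0 within {0..1}. norm (t powr p * g t) \<le> C * t powr (p + real n)"
        unfolding eventually_at_filter
      proof (intro always_eventually allI impI)
        fix t :: real assume t: "t \<noteq> 0" "t \<in> {0..1}"
        have "norm (t powr p * g t) \<le> t powr p * (C * t ^ n)"
          using le[OF t(2)] by (simp add: abs_mult mult_left_mono)
        also have "\<dots> = C * t powr (p + real n)"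
          using t by (simp add: powr_add powr_realpow)
        finally show "norm (t powr p * g t) \<le> C * t powr (p + real n)" .
      qed
    qed
    then show ?thesis using True by simp
  qed
qed

text \<open>Integration by parts with a possibly singular power. The gauge integral needs no integrability of
the derivative near the origin, only continuity of the primitive there; this is why the whole sign
analysis below uses \<open>has_integral\<close>.\<close>

lemma has_integral_powr_mult_derivative:
  fixes g g' :: "real \<Rightarrow> real"
  assumes g: "\<And>t. (g has_real_derivative g' t) (at t)"
    and le: "\<And>t. t \<in> {0..1} \<Longrightarrow> \<bar>g t\<bar> \<le> C * t ^ n" and pos: "p + real n > 0"
  shows "((\<lambda>t. p * (t powr (p - 1) * g t) + t powr p * g' t) has_integral g 1) {0..1}"
proof -
  have c: "continuous_on {0..1} g"
    by (meson DERIV_continuous_on DERIV_subset g has_field_derivative_at_within)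
  have "((\<lambda>t. p * (t powr (p - 1) * g t) + t powr p * g' t) has_integral
           1 powr p * g 1 - 0 powr p * g 0) {0..1}"
  proof (rule fundamental_theorem_of_calculus_interior)
    show "continuous_on {0..1} (\<lambda>t. t powr p * g t)"
      by (rule continuous_on_powr_mult[OF c le pos])
    fix t :: real assume "t \<in> {0<..<1}"
    then show "((\<lambda>t. t powr p * g t) has_vector_derivative p * (t powr (p - 1) * g t) + t powr p * g' t) (at t)"
      unfolding has_real_derivative_iff_has_vector_derivative[symmetric]
      by (auto intro!: derivative_eq_intros g simp: algebra_simps)
  qed simp
  then show ?thesis by simp
qed

lemma one_minus_cos_le: "\<bar>1 - cos x\<bar> \<le> x\<^sup>2 / 2" for x :: real
proof -
  have "1 - cos x = 2 * (sin (x / 2))\<^sup>2"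
    using cos_double_sin[of "x / 2"] by simp
  moreover have "(sin (x / 2))\<^sup>2 \<le> (x / 2)\<^sup>2"
    using abs_sin_x_le_abs_x[of "x / 2"] by (metis abs_le_square_iff)
  ultimately show ?thesis by (simp add: power2_eq_square)
qed

lemma one_minus_cos_ge:
  fixes x :: real
  assumes "0 \<le> x" "x \<le> 1"
  shows "1 - cos x \<ge> x\<^sup>2 / 4" 
proof -
  have half: "cos y \<ge> 1 / 2" if "0 \<le> y" "y \<le> 1" for y :: real
    using cos_monotone_0_pi_le[of y "pi / 3"] that pi_gt3 by (simp add: cos_60)
  have s: "sin y \<ge> y / 2" if y: "0 \<le> y" "y \<le> 1" for y :: real
  proof -
    have "sin 0 - 0 / 2 \<le> sin y - y / 2"
    proof (rule DERIV_nonneg_imp_nondecreasing[of 0 y "\<lambda>y. sin y - y / 2", OF y(1)])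
      fix z assume "0 \<le> z" "z \<le> y"
      then show "\<exists>d. ((\<lambda>y. sin y - y / 2) has_real_derivative d) (at z) \<and> 0 \<le> d"
        using half[of z] y
        by (intro exI[of _ "cos z - 1 / 2"]) (auto intro!: derivative_eq_intros)
    qed
    then show ?thesis by simp
  qed
  have "1 - cos 0 - 0\<^sup>2 / 4 \<le> 1 - cos x - x\<^sup>2 / 4"
  proof (rule DERIV_nonneg_imp_nondecreasing[of 0 x "\<lambda>x. 1 - cos x - x\<^sup>2 / 4", OF assms(1)])
    fix z assume "0 \<le> z" "z \<le> x"
    then show "\<exists>d. ((\<lambda>x. 1 - cos x - x\<^sup>2 / 4) has_real_derivative d) (at z) \<and> 0 \<le> d"
      using s[of z] assms
      by (intro exI[of _ "sin z - z / 2"]) (auto intro!: derivative_eq_intros)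
  qed
  then show ?thesis by simp
qed

text \<open>The relevant frequencies are the zeros of the cosine, so every boundary term at \<open>t = 1\<close> that
contains a cosine vanishes, and \<open>sin \<omega>\<close> is \<open>1\<close> or \<open>-1\<close>. Repeated integration by parts moves the
coefficient \<open>c\<close> to integrals of \<open>t powr (\<alpha> - j)\<close> against a sine, a cosine, or the nonnegative
function \<open>1 - cos (\<omega> * t)\<close>; which of these integrals controls the sign of \<open>c\<close> depends on \<open>\<alpha>\<close>.\<close>

locale quarter_wave =
  fixes \<alpha> \<omega> c :: real
  assumes \<alpha>: "\<alpha> > 0" and \<omega>: "\<omega> > 0" and cos_zero: "cos \<omega> = 0"
  defines "c \<equiv> integral {0..1} (\<lambda>t. (1 - t powr \<alpha>) * cos (\<omega> * t))"
begin

lemma has_integral_sin: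
  "((\<lambda>t. t powr (\<alpha> - 1) * sin (\<omega> * t)) has_integral \<omega> * c / \<alpha>) {0..1}"
proof -
  have "((\<lambda>t. (1 - t powr \<alpha>) * cos (\<omega> * t)) has_integral c) {0..1}"
    unfolding c_def using \<alpha>
    by (intro integrable_integral integrable_continuous_real continuous_intros continuous_on_powr') auto
  then have A: "((\<lambda>t. \<omega> * ((1 - t powr \<alpha>) * cos (\<omega> * t))) has_integral \<omega> * c) {0..1}"
    by (rule has_integral_mult_right)
  have B: "((\<lambda>t. \<alpha> * (t powr (\<alpha> - 1) * sin (\<omega> * t)) + t powr \<alpha> * (\<omega> * cos (\<omega> * t)))
      has_integral sin (\<omega> * 1)) {0..1}"
    by (rule has_integral_powr_mult_derivative[where n = 0 and C = 1])
       (use \<alpha> in \<open>auto intro!: derivative_eq_intros\<close>)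
  have C: "((\<lambda>t. \<omega> * cos (\<omega> * t)) has_integral sin (\<omega> * 1) - sin (\<omega> * 0)) {0..1}"
    by (rule fundamental_theorem_of_calculus)
       (auto intro!: derivative_eq_intros simp: has_real_derivative_iff_has_vector_derivative[symmetric])
  have "((\<lambda>t. 1 / \<alpha> * (\<omega> * ((1 - t powr \<alpha>) * cos (\<omega> * t)) +
      (\<alpha> * (t powr (\<alpha> - 1) * sin (\<omega> * t)) + t powr \<alpha> * (\<omega> * cos (\<omega> * t)) - \<omega> * cos (\<omega> * t))))
     has_integral 1 / \<alpha> * (\<omega> * c + (sin (\<omega> * 1) - (sin (\<omega> * 1) - sin (\<omega> * 0))))) {0..1}"
    by (intro has_integral_mult_right has_integral_add has_integral_diff A B C)
  moreover have "1 / \<alpha> * (\<omega> * ((1 - t powr \<alpha>) * cos (\<omega> * t)) +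
      (\<alpha> * (t powr (\<alpha> - 1) * sin (\<omega> * t)) + t powr \<alpha> * (\<omega> * cos (\<omega> * t)) - \<omega> * cos (\<omega> * t)))
      = t powr (\<alpha> - 1) * sin (\<omega> * t)" for t
    using \<alpha> by (simp add: field_simps)
  ultimately show ?thesis by simp
qed

lemma has_integral_powr_mult_one_minus_cos:
  assumes "p + 2 > 0"
  shows "((\<lambda>t. p * (t powr (p - 1) * (1 - cos (\<omega> * t))) + \<omega> * (t powr p * sin (\<omega> * t)))
      has_integral 1) {0..1}"
proof -
  have "((\<lambda>t. p * (t powr (p - 1) * (1 - cos (\<omega> * t))) + t powr p * (\<omega> * sin (\<omega> * t)))
      has_integral 1 - cos (\<omega> * 1)) {0..1}"
    by (rule has_integral_powr_mult_derivative[where n = 2 and C = "\<omega>\<^sup>2 / 2"])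
       (use assms one_minus_cos_le[of "\<omega> * t" for t] in
         \<open>auto intro!: derivative_eq_intros simp: power_mult_distrib\<close>)
  then show ?thesis by (simp add: cos_zero mult_ac)
qed

text \<open>The weight \<open>t powr (\<alpha> - 1)\<close> is nonincreasing, so the positive half waves of the sine win. The
primitive \<open>1 - cos (\<omega> * t)\<close> of the sine, which is nonnegative, makes this an integration by parts.\<close>

lemma coeff_pos_if_le_1:
  assumes "\<alpha> \<le> 1"
  shows "c > 0"
proof -
  have "((\<lambda>t. (\<alpha> - 1) * (t powr (\<alpha> - 1 - 1) * (1 - cos (\<omega> * t))) + \<omega> * (t powr (\<alpha> - 1) * sin (\<omega> * t)))
      has_integral 1) {0..1}"
    by (rule has_integral_powr_mult_one_minus_cos) (use \<alpha> in simp)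
  from has_integral_diff[OF has_integral_mult_right[OF has_integral_sin, of \<omega>] this]
  have "((\<lambda>t. (1 - \<alpha>) * (t powr (\<alpha> - 1 - 1) * (1 - cos (\<omega> * t)))) has_integral \<omega> * (\<omega> * c / \<alpha>) - 1) {0..1}"
    by (simp add: algebra_simps)
  from has_integral_nonneg[OF this] have "\<omega> * (\<omega> * c / \<alpha>) \<ge> 1" using assms by simp
  then have "\<omega> * \<omega> * c \<ge> \<alpha>" using \<alpha> by (simp add: field_simps)
  with \<alpha> have "\<omega> * \<omega> * c > 0" by linarith
  then show ?thesis using \<omega> by (simp add: zero_less_mult_iff)
qed

lemma has_integral_cos:
  assumes "\<alpha> > 1"
  shows "((\<lambda>t. t powr (\<alpha> - 2) * cos (\<omega> * t)) has_integral \<omega>\<^sup>2 * c / (\<alpha> * (\<alpha> - 1))) {0..1}"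
proof -
  have "((\<lambda>t. (\<alpha> - 1) * (t powr (\<alpha> - 1 - 1) * cos (\<omega> * t)) + t powr (\<alpha> - 1) * (- \<omega> * sin (\<omega> * t)))
      has_integral cos (\<omega> * 1)) {0..1}"
    by (rule has_integral_powr_mult_derivative[where n = 0 and C = 1])
       (use assms in \<open>auto intro!: derivative_eq_intros\<close>)
  from has_integral_mult_right[OF has_integral_add[OF this has_integral_mult_right[OF has_integral_sin, of \<omega>]],
      of "1 / (\<alpha> - 1)"]
  show ?thesis using assms by (simp add: cos_zero power2_eq_square mult_ac)
qed

lemma has_integral_powr_minus_3_sin:
  assumes "\<alpha> > 1"
  shows "((\<lambda>t. (\<alpha> - 2) * (t powr (\<alpha> - 3) * sin (\<omega> * t)))
      has_integral sin \<omega> - \<omega> * (\<omega>\<^sup>2 * c / (\<alpha> * (\<alpha> - 1)))) {0..1}"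
proof -
  have "((\<lambda>t. (\<alpha> - 2) * (t powr (\<alpha> - 2 - 1) * sin (\<omega> * t)) + t powr (\<alpha> - 2) * (\<omega> * cos (\<omega> * t)))
      has_integral sin (\<omega> * 1)) {0..1}"
  proof (rule has_integral_powr_mult_derivative[where n = 1 and C = \<omega>])
    show "\<bar>sin (\<omega> * t)\<bar> \<le> \<omega> * t ^ 1" if "t \<in> {0..1}" for t
      using abs_sin_x_le_abs_x[of "\<omega> * t"] that \<omega> by (simp add: abs_mult)
  qed (use assms in \<open>auto intro!: derivative_eq_intros\<close>)
  from has_integral_diff[OF this has_integral_mult_right[OF has_integral_cos[OF assms], of \<omega>]]
  show ?thesis by (simp add: mult_ac)
qed

text \<open>For \<open>1 < \<alpha> < 2\<close> the profile is not twice differentiable at the origin, and the contribution of this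
singularity, of order \<open>\<omega> powr (-1 - \<alpha>)\<close> and of fixed sign, outweighs the alternating contribution
of the endpoint, of order \<open>\<omega> powr (-2)\<close>. The lemma says so quantitatively: a coefficient with the
alternating sign bounds the frequency. The contribution of the origin is bounded below by the part
of the integral of \<open>t powr (\<alpha> - 4) * (1 - cos (\<omega> * t))\<close> over \<open>t \<le> 1 / \<omega>\<close>, where
\<open>1 - cos (\<omega> * t)\<close> is at least \<open>(\<omega> * t)\<^sup>2 / 4\<close>.\<close>

lemma coeff_lower_bound_if_between_1_2:
  assumes \<alpha>12: "1 < \<alpha>" "\<alpha> < 2" and s: "sin \<omega> = -1" and c: "c \<le> 0" and \<omega>1: "\<omega> \<ge> 1"
  shows "\<omega> powr (2 - \<alpha>) \<le> 4 * (\<alpha> - 1) / ((2 - \<alpha>) * (3 - \<alpha>))"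
proof -
  define B where "B = \<omega>\<^sup>2 * c / (\<alpha> * (\<alpha> - 1))"
  have B: "B \<le> 0" unfolding B_def using assms \<omega>
    by (intro divide_nonpos_pos mult_nonneg_nonpos) auto
  have "1 / (\<alpha> - 2) * (sin \<omega> - \<omega> * B) = (1 + \<omega> * B) / (2 - \<alpha>)"
    using \<alpha>12 unfolding s by (simp add: divide_simps) (simp add: algebra_simps)
  then have K: "((\<lambda>t. t powr (\<alpha> - 3) * sin (\<omega> * t)) has_integral (1 + \<omega> * B) / (2 - \<alpha>)) {0..1}"
    using has_integral_mult_right[OF has_integral_powr_minus_3_sin[OF \<alpha>12(1)], of "1 / (\<alpha> - 2)"] \<alpha>12
    unfolding B_def[symmetric] by simp
  have "((\<lambda>t. (\<alpha> - 3) * (t powr (\<alpha> - 3 - 1) * (1 - cos (\<omega> * t))) + \<omega> * (t powr (\<alpha> - 3) * sin (\<omega> * t)))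
      has_integral 1) {0..1}"
    by (rule has_integral_powr_mult_one_minus_cos) (use assms in simp)
  from has_integral_diff[OF has_integral_mult_right[OF K, of \<omega>] this]
  have L: "((\<lambda>t. (3 - \<alpha>) * (t powr (\<alpha> - 4) * (1 - cos (\<omega> * t)))) has_integral
      \<omega> * ((1 + \<omega> * B) / (2 - \<alpha>)) - 1) {0..1}"
    by (simp add: algebra_simps)
  have P: "((\<lambda>t. (3 - \<alpha>) * \<omega>\<^sup>2 / 4 * t powr (\<alpha> - 2)) has_integral
      (3 - \<alpha>) * \<omega>\<^sup>2 / 4 * ((1 / \<omega>) powr (\<alpha> - 2 + 1) / (\<alpha> - 2 + 1))) {0..1/\<omega>}"
    by (intro has_integral_mult_right has_integral_powr_from_0) (use assms in auto)
  have P': "((\<lambda>t. if t \<in> {0..1/\<omega>} then (3 - \<alpha>) * \<omega>\<^sup>2 / 4 * t powr (\<alpha> - 2) else 0) has_integral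
      (3 - \<alpha>) * \<omega>\<^sup>2 / 4 * ((1 / \<omega>) powr (\<alpha> - 2 + 1) / (\<alpha> - 2 + 1))) {0..1}"
    by (subst has_integral_restrict) (use \<omega>1 in simp, rule P)
  have "(3 - \<alpha>) * \<omega>\<^sup>2 / 4 * ((1 / \<omega>) powr (\<alpha> - 2 + 1) / (\<alpha> - 2 + 1)) \<le> \<omega> * ((1 + \<omega> * B) / (2 - \<alpha>)) - 1"
  proof (rule has_integral_le[OF P' L])
    fix t :: real assume t: "t \<in> {0..1}"
    show "(if t \<in> {0..1/\<omega>} then (3 - \<alpha>) * \<omega>\<^sup>2 / 4 * t powr (\<alpha> - 2) else 0)
        \<le> (3 - \<alpha>) * (t powr (\<alpha> - 4) * (1 - cos (\<omega> * t)))"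
    proof (cases "t \<in> {0..1/\<omega>} \<and> t \<noteq> 0")
      case True
      then have "t > 0" "\<omega> * t \<le> 1" using \<omega> by (auto simp: field_simps)
      have "(\<omega> * t)\<^sup>2 / 4 \<le> 1 - cos (\<omega> * t)"
        by (rule one_minus_cos_ge) (use \<open>t > 0\<close> \<open>\<omega> * t \<le> 1\<close> \<omega> in auto)
      then have "t powr (\<alpha> - 4) * ((\<omega> * t)\<^sup>2 / 4) \<le> t powr (\<alpha> - 4) * (1 - cos (\<omega> * t))"
        by (rule mult_left_mono) simp
      moreover have "t powr (\<alpha> - 2) = t powr (\<alpha> - 4) * t\<^sup>2"
        using powr_add[of t "\<alpha> - 4" 2] \<open>t > 0\<close> by simp
      ultimately have "\<omega>\<^sup>2 / 4 * t powr (\<alpha> - 2) \<le> t powr (\<alpha> - 4) * (1 - cos (\<omega> * t))"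
        by (simp add: power_mult_distrib mult_ac)
      from mult_left_mono[OF this, of "3 - \<alpha>"] show ?thesis using True assms by (simp add: mult_ac)
    next
      case False
      then show ?thesis using assms by auto
    qed
  qed
  also have "\<dots> \<le> \<omega> / (2 - \<alpha>)"
  proof -
    have "(1 + \<omega> * B) \<le> 1" using B \<omega> by (simp add: mult_nonneg_nonpos)
    then have "\<omega> * ((1 + \<omega> * B) / (2 - \<alpha>)) \<le> \<omega> * (1 / (2 - \<alpha>))"
      using \<omega> \<alpha>12 by (intro mult_left_mono divide_right_mono) auto
    then show ?thesis by simp
  qed
  finally have "(3 - \<alpha>) * \<omega>\<^sup>2 / 4 * ((1 / \<omega>) powr (\<alpha> - 1) / (\<alpha> - 1)) \<le> \<omega> / (2 - \<alpha>)" by simp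
  moreover have "\<omega>\<^sup>2 * (1 / \<omega>) powr (\<alpha> - 1) = \<omega> * \<omega> powr (2 - \<alpha>)"
  proof -
    have "(1 / \<omega>) powr (\<alpha> - 1) = \<omega> powr (1 - \<alpha>)"
      using \<omega> by (simp add: powr_divide powr_minus_divide[symmetric])
    moreover have "\<omega> * \<omega> powr (1 - \<alpha>) = \<omega> powr (2 - \<alpha>)"
      using powr_add[of \<omega> 1 "1 - \<alpha>"] \<omega> by simp
    ultimately show ?thesis by (simp add: power2_eq_square)
  qed
  ultimately have "\<omega> * ((3 - \<alpha>) / (4 * (\<alpha> - 1)) * \<omega> powr (2 - \<alpha>)) \<le> \<omega> * (1 / (2 - \<alpha>))"
    by (simp add: mult_ac)
  then have "(3 - \<alpha>) / (4 * (\<alpha> - 1)) * \<omega> powr (2 - \<alpha>) \<le> 1 / (2 - \<alpha>)"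
    using \<omega> by (simp only: mult_le_cancel_left_pos)
  then show ?thesis using \<alpha>12 by (simp add: divide_simps) (simp add: algebra_simps)
qed

text \<open>For \<open>\<alpha> \<ge> 2\<close> the endpoint contribution dominates: up to a positive factor, \<open>sin \<omega> * c\<close> is the
integral of \<open>(\<alpha> - 2) * t powr (\<alpha> - 3)\<close>, whose total mass is \<open>1\<close>, against the nonnegative function
\<open>1 - sin \<omega> * sin (\<omega> * t)\<close>. Strictness matters later. It holds because the latter function is not
zero near \<open>t = 1 / (2 * \<omega>)\<close>; for \<open>\<alpha> = 2\<close> the mass sits at the origin and the value is exactly \<open>1\<close>.\<close>

lemma coeff_sign_if_ge_2:
  assumes \<alpha>2: "\<alpha> \<ge> 2" and \<omega>1: "\<omega> \<ge> 1"
  shows "sin \<omega> * c > 0"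
proof -
  define B where "B = \<omega>\<^sup>2 * c / (\<alpha> * (\<alpha> - 1))"
  have s: "sin \<omega> * sin \<omega> = 1" using sin_cos_squared_add[of \<omega>] cos_zero by (simp add: power2_eq_square)
  have sK: "((\<lambda>t. sin \<omega> * ((\<alpha> - 2) * (t powr (\<alpha> - 3) * sin (\<omega> * t)))) has_integral
      1 - sin \<omega> * (\<omega> * B)) {0..1}"
    using has_integral_mult_right[OF has_integral_powr_minus_3_sin, of "sin \<omega>"] \<alpha>2
    unfolding B_def[symmetric] by (simp add: right_diff_distrib s)
  have "sin \<omega> * (\<omega> * B) > 0"
  proof (cases "\<alpha> = 2")
    case True
    have "((\<lambda>t::real. 0) has_integral 1 - sin \<omega> * (\<omega> * B)) {0..1}"
      using sK True by simp
    then show ?thesis using has_integral_unique[OF has_integral_0] by fastforce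
  next
    case False
    then have \<alpha>2': "\<alpha> > 2" using \<alpha>2 by simp
    define D where "D = (\<lambda>t. (\<alpha> - 2) * t powr (\<alpha> - 3) * (1 - sin \<omega> * sin (\<omega> * t)))"
    have "((\<lambda>t. (\<alpha> - 2) * t powr (\<alpha> - 3)) has_integral (\<alpha> - 2) * (1 powr (\<alpha> - 3 + 1) / (\<alpha> - 3 + 1))) {0..1}"
      by (intro has_integral_mult_right has_integral_powr_from_0) (use \<alpha>2' in auto)
    from has_integral_diff[OF this sK]
    have D: "(D has_integral sin \<omega> * (\<omega> * B)) {0..1}"
      using \<alpha>2' by (simp add: D_def algebra_simps)
    have D_nonneg: "D t \<ge> 0" for t
    proof -
      have "\<bar>sin \<omega> * sin (\<omega> * t)\<bar> \<le> 1 * 1"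
        unfolding abs_mult by (intro mult_mono) auto
      then show ?thesis using \<alpha>2 by (simp add: D_def)
    qed
    have "sin \<omega> * (\<omega> * B) \<noteq> 0"
    proof
      assume "sin \<omega> * (\<omega> * B) = 0"
      \<comment> \<open>At this point \<open>sin (\<omega> * a) = sin (1 / 2)\<close> is less than \<open>1\<close>; restricting to \<open>{a..1}\<close> also avoids
        the singularity of the weight at the origin.\<close>
      define a where "a = 1 / (2 * \<omega>)"
      have a: "0 < a" "a < 1" using \<omega>1 by (auto simp: a_def)
      have cont: "continuous_on {a..1} D"
        unfolding D_def using a by (intro continuous_intros) auto
      then have Da: "(D has_integral integral {a..1} D) {a..1}"
        by (intro integrable_integral integrable_continuous_real)
      have "integral {a..1} D \<le> 0"
        by (rule has_integral_subset_le[OF _ Da D[unfolded \<open>sin \<omega> * (\<omega> * B) = 0\<close>]])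
           (use a D_nonneg in auto)
      moreover have "integral {a..1} D \<ge> 0"
        by (rule has_integral_nonneg[OF Da]) (rule D_nonneg)
      ultimately have "(D has_integral 0) {a..1}" using Da by simp
      then have "D a = 0"
        using has_integral_0_cbox_imp_0[of a 1 D a] cont a D_nonneg by (simp add: box_real)
      then have "sin \<omega> * sin (\<omega> * a) = 1" using \<alpha>2' a by (simp add: D_def)
      moreover have "\<omega> * a = 1 / 2" using \<omega> by (simp add: a_def)
      ultimately have "1 = \<bar>sin \<omega>\<bar> * \<bar>sin (1 / 2)\<bar>" by (metis abs_mult abs_one)
      also have "\<dots> \<le> 1 * \<bar>1 / 2\<bar>"
        by (intro mult_mono abs_sin_x_le_abs_x) auto
      finally show False by simp
    qed
    moreover have "sin \<omega> * (\<omega> * B) \<ge> 0" by (rule has_integral_nonneg[OF D]) (rule D_nonneg)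
    ultimately show ?thesis by linarith
  qed
  moreover have "sin \<omega> * (\<omega> * B) = \<omega> * \<omega>\<^sup>2 / (\<alpha> * (\<alpha> - 1)) * (sin \<omega> * c)"
    by (simp add: B_def)
  moreover have "\<omega> * \<omega>\<^sup>2 / (\<alpha> * (\<alpha> - 1)) > 0" using \<omega> \<alpha>2 by simp
  ultimately show ?thesis by (simp only: zero_less_mult_iff) auto
qed

end

section \<open>Completeness of the half-integer cosine modes\<close>

text \<open>Only functions that are continuous on the closed interval are ever paired, so no quotient by null
functions is needed.\<close>

definition L2_inner :: "(real \<Rightarrow> real) \<Rightarrow> (real \<Rightarrow> real) \<Rightarrow> real" where
  "L2_inner p q = integral {-1/2..1/2} (\<lambda>x. p x * q x)"

definition cos_mode :: "nat \<Rightarrow> real \<Rightarrow> real" where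
  "cos_mode k x = cos ((2 * real k + 1) * pi * x)"

lemma continuous_on_cos_mode [continuous_intros]: "continuous_on A (cos_mode k)"
  unfolding cos_mode_def by (intro continuous_intros)

lemma L2_inner_commute: "L2_inner p q = L2_inner q p"
  by (simp add: L2_inner_def mult.commute)

lemma L2_inner_has_integral:
  assumes "continuous_on {-1/2..1/2} p" "continuous_on {-1/2..1/2} q"
  shows "((\<lambda>x. p x * q x) has_integral L2_inner p q) {-1/2..1/2}"
  unfolding L2_inner_def using assms
  by (intro integrable_integral integrable_continuous_real continuous_intros)

lemma L2_inner_add_right:
  assumes "continuous_on {-1/2..1/2} p" "continuous_on {-1/2..1/2} q" "continuous_on {-1/2..1/2} r"
  shows "L2_inner p (\<lambda>x. q x + r x) = L2_inner p q + L2_inner p r"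
proof -
  have "((\<lambda>x. p x * q x + p x * r x) has_integral L2_inner p q + L2_inner p r) {-1/2..1/2}"
    by (intro has_integral_add L2_inner_has_integral assms)
  then show ?thesis unfolding L2_inner_def[of p "\<lambda>x. q x + r x"]
    by (intro integral_unique) (simp add: distrib_left)
qed

lemma L2_inner_scale_right: "L2_inner p (\<lambda>x. a * q x) = a * L2_inner p q"
  unfolding L2_inner_def integral_mult_right[symmetric] by (simp add: mult_ac)

lemma L2_inner_scale_left: "L2_inner (\<lambda>x. a * p x) q = a * L2_inner p q"
  using L2_inner_scale_right by (simp add: L2_inner_commute)

lemma L2_inner_add_left:
  assumes "continuous_on {-1/2..1/2} p" "continuous_on {-1/2..1/2} q" "continuous_on {-1/2..1/2} r"
  shows "L2_inner (\<lambda>x. p x + q x) r = L2_inner p r + L2_inner q r"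
  using L2_inner_add_right[of r p q] assms by (simp add: L2_inner_commute)

lemma L2_inner_diff_right:
  assumes "continuous_on {-1/2..1/2} p" "continuous_on {-1/2..1/2} q" "continuous_on {-1/2..1/2} r"
  shows "L2_inner p (\<lambda>x. q x - r x) = L2_inner p q - L2_inner p r"
  using L2_inner_add_right[of p q "\<lambda>x. (-1) * r x"] L2_inner_scale_right[of p "-1" r] assms
  by (simp add: continuous_on_minus)

lemma L2_inner_diff_left:
  assumes "continuous_on {-1/2..1/2} p" "continuous_on {-1/2..1/2} q" "continuous_on {-1/2..1/2} r"
  shows "L2_inner (\<lambda>x. p x - q x) r = L2_inner p r - L2_inner q r"
  using L2_inner_diff_right[of r p q] assms by (simp add: L2_inner_commute)

lemma L2_inner_sum_left:
  assumes "\<And>k. k \<in> A \<Longrightarrow> continuous_on {-1/2..1/2} (p k)" "continuous_on {-1/2..1/2} q"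
  shows "L2_inner (\<lambda>x. \<Sum>k\<in>A. p k x) q = (\<Sum>k\<in>A. L2_inner (p k) q)"
proof (cases "finite A")
  case True
  have "((\<lambda>x. \<Sum>k\<in>A. p k x * q x) has_integral (\<Sum>k\<in>A. L2_inner (p k) q)) {-1/2..1/2}"
    by (intro has_integral_sum True L2_inner_has_integral assms)
  then show ?thesis unfolding L2_inner_def[of "\<lambda>x. \<Sum>k\<in>A. p k x"]
    by (intro integral_unique) (simp add: sum_distrib_right)
qed (simp add: L2_inner_def)

lemma L2_inner_mono:
  assumes "continuous_on {-1/2..1/2} p" "continuous_on {-1/2..1/2} q"
    "continuous_on {-1/2..1/2} p'" "continuous_on {-1/2..1/2} q'"
    and "\<And>x. x \<in> {-1/2..1/2} \<Longrightarrow> p x * q x \<le> p' x * q' x"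
  shows "L2_inner p q \<le> L2_inner p' q'"
  by (rule has_integral_le[OF L2_inner_has_integral L2_inner_has_integral]) (use assms in auto)

text \<open>This weak form of the Cauchy-Schwarz inequality suffices, because one factor can be rescaled
before it is applied.\<close>

lemma L2_inner_young:
  assumes p: "continuous_on {-1/2..1/2} p" and q: "continuous_on {-1/2..1/2} q"
  shows "2 * L2_inner p q \<le> L2_inner p p + L2_inner q q"
proof -
  have "((\<lambda>x. p x * p x + q x * q x - 2 * (p x * q x)) has_integral L2_inner p p + L2_inner q q - 2 * L2_inner p q) {-1/2..1/2}"
    by (intro has_integral_diff has_integral_add has_integral_mult_right L2_inner_has_integral p q)
  moreover have "p x * p x + q x * q x - 2 * (p x * q x) = (p x - q x)\<^sup>2" for x
    by (simp add: power2_eq_square algebra_simps)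
  ultimately have "((\<lambda>x. (p x - q x)\<^sup>2) has_integral L2_inner p p + L2_inner q q - 2 * L2_inner p q) {-1/2..1/2}"
    by (simp only:)
  from has_integral_nonneg[OF this] show ?thesis by simp
qed

lemma integral_cos_2pi_int:
  "((\<lambda>x. cos (2 * pi * of_int n * x)) has_integral (if n = 0 then 1 else 0)) {-1/2..1/2::real}"
proof (cases "n = 0")
  case True
  then show ?thesis using has_integral_const_real[of "1::real" "-1/2" "1/2"] by simp
next
  case False
  define a where "a = 2 * pi * of_int n"
  have a: "a \<noteq> 0" using False by (simp add: a_def)
  have "((\<lambda>x. cos (a * x)) has_integral sin (a * (1/2)) / a - sin (a * (-1/2)) / a) {-1/2..1/2::real}"
  proof (rule fundamental_theorem_of_calculus)
    fix x :: real
    show "((\<lambda>x. sin (a * x) / a) has_vector_derivative cos (a * x)) (at x within {-1/2..1/2})"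
      unfolding has_real_derivative_iff_has_vector_derivative[symmetric]
      using a by (auto intro!: derivative_eq_intros)
  qed simp
  moreover have "sin (a * (1/2)) = 0"
    using sin_int_times_real[of n] by (simp add: a_def mult_ac)
  ultimately show ?thesis using False unfolding a_def by simp
qed

lemma L2_inner_cos_mode: "L2_inner (cos_mode j) (cos_mode k) = (if j = k then 1 / 2 else 0)"
proof -
  have "((\<lambda>x. 1 / 2 * (cos (2 * pi * of_int (int j - int k) * x) + cos (2 * pi * of_int (int j + int k + 1) * x)))
     has_integral 1 / 2 * ((if int j - int k = 0 then 1 else 0) + (if int j + int k + 1 = 0 then 1 else 0)))
     {-1/2..1/2::real}"
    by (intro has_integral_mult_right has_integral_add integral_cos_2pi_int)
  moreover have "1 / 2 * (cos (2 * pi * of_int (int j - int k) * x) + cos (2 * pi * of_int (int j + int k + 1) * x))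
     = cos_mode j x * cos_mode k x" for x
    unfolding cos_mode_def cos_times_cos by (simp add: algebra_simps)
  ultimately show ?thesis unfolding L2_inner_def by (intro integral_unique) auto
qed

text \<open>The linear span of the modes. Its inductive form lets properties of the span be proved without
handling coefficients.\<close>

inductive cos_poly :: "(real \<Rightarrow> real) \<Rightarrow> bool" where
  mode: "cos_poly (cos_mode k)"
| add: "cos_poly p \<Longrightarrow> cos_poly q \<Longrightarrow> cos_poly (\<lambda>x. p x + q x)"
| scale: "cos_poly p \<Longrightarrow> cos_poly (\<lambda>x. a * p x)"

lemma continuous_on_cos_poly: "cos_poly p \<Longrightarrow> continuous_on A p"
  by (induction rule: cos_poly.induct) (auto intro: continuous_intros)

text \<open>Multiplication by \<open>(cos (pi * x))\<^sup>2\<close>, which is \<open>(1 + cos (2 * pi * x)) / 2\<close>, couples a mode only to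
its two neighbours. Below the lowest mode lies the frequency \<open>-pi\<close>, which gives the lowest mode
again. Consequently the span contains every odd power of \<open>cos (pi * x)\<close>.\<close>

lemma cos_poly_mult_cos_squared: "cos_poly p \<Longrightarrow> cos_poly (\<lambda>x. (cos (pi * x))\<^sup>2 * p x)"
proof (induction rule: cos_poly.induct)
  case (mode k)
  have low: "cos_poly (\<lambda>x. cos ((2 * real k - 1) * pi * x))"
  proof (cases k)
    case 0
    then have "(\<lambda>x. cos ((2 * real k - 1) * pi * x)) = cos_mode 0" by (auto simp: cos_mode_def)
    then show ?thesis by (simp add: cos_poly.mode)
  next
    case (Suc n)
    then have "(\<lambda>x. cos ((2 * real k - 1) * pi * x)) = cos_mode n"
      by (auto simp: cos_mode_def fun_eq_iff algebra_simps)
    then show ?thesis by (simp add: cos_poly.mode)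
  qed
  have "(cos (pi * x))\<^sup>2 * cos_mode k x
      = 1 / 4 * (cos_mode (Suc k) x + (2 * cos_mode k x + cos ((2 * real k - 1) * pi * x)))" for x
  proof -
    define u where "u = (2 * real k + 1) * pi * x"
    define v where "v = pi * x"
    have e: "cos_mode (Suc k) x = cos (u + 2 * v)" "cos_mode k x = cos u"
      "cos ((2 * real k - 1) * pi * x) = cos (u - 2 * v)"
      by (auto simp: cos_mode_def u_def v_def algebra_simps)
    have "cos (u + 2 * v) + cos (u - 2 * v) = 2 * cos u * (2 * (cos v)\<^sup>2 - 1)"
      unfolding cos_add cos_diff cos_double_cos by simp
    then show ?thesis unfolding e v_def[symmetric] by (simp add: algebra_simps)
  qed
  then show ?case by (simp only:) (intro cos_poly.intros low)
next
  case (add p q)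
  then show ?case using cos_poly.add[OF add.IH] by (simp add: distrib_left)
next
  case (scale p a)
  then show ?case using cos_poly.scale[OF scale.IH, of a] by (simp add: mult_ac)
qed

lemma cos_poly_odd_power: "cos_poly (\<lambda>x. cos (pi * x) ^ (2 * j + 1))"
proof (induction j)
  case 0
  have "(\<lambda>x. cos (pi * x) ^ (2 * 0 + 1)) = cos_mode 0" by (simp add: cos_mode_def fun_eq_iff)
  then show ?case by (simp add: cos_poly.mode)
next
  case (Suc j)
  have "(\<lambda>x. cos (pi * x) ^ (2 * Suc j + 1)) = (\<lambda>x. (cos (pi * x))\<^sup>2 * cos (pi * x) ^ (2 * j + 1))"
    by (simp add: fun_eq_iff power_add power2_eq_square)
  then show ?case using cos_poly_mult_cos_squared[OF Suc.IH] by simp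
qed

lemma cos_poly_zero: "cos_poly (\<lambda>x. 0)"
  using cos_poly.scale[OF cos_poly.mode, of 0] by simp

lemma cos_poly_sum:
  "finite A \<Longrightarrow> (\<And>i. i \<in> A \<Longrightarrow> cos_poly (p i)) \<Longrightarrow> cos_poly (\<lambda>x. \<Sum>i\<in>A. p i x)"
  by (induction A rule: finite_induct) (auto intro: cos_poly_zero cos_poly.add)

text \<open>Reflecting \<open>h\<close> at the point \<open>1/2\<close> with a change of sign gives a continuous function on the unit
interval, precisely because \<open>h\<close> vanishes there. In the variable \<open>y = cos (pi * x)\<close> this extension
is an odd continuous function on \<open>{-1..1}\<close>, so the odd part of an approximating polynomial
approximates it equally well; and odd powers of \<open>y\<close> belong to the span of the modes.\<close>

lemma cos_poly_dense:
  assumes h: "continuous_on {-1/2..1/2} h" and even: "\<And>x. x \<in> {-1/2..1/2} \<Longrightarrow> h (- x) = h x"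
    and zero: "h (1/2) = 0" and "\<epsilon> > 0"
  obtains P where "cos_poly P" "\<And>x. x \<in> {-1/2..1/2} \<Longrightarrow> \<bar>h x - P x\<bar> \<le> \<epsilon>"
proof -
  define H where "H = (\<lambda>x. if x \<le> 1/2 then h x else - h (1 - x))"
  have H: "continuous_on {0..1} H"
  proof -
    have "continuous_on ({0..1/2} \<union> {1/2..1}) H"
      unfolding H_def
    proof (rule continuous_on_cases)
      show "continuous_on {0..1/2} h" by (rule continuous_on_subset[OF h]) auto
      show "continuous_on {1/2..1} (\<lambda>x. - h (1 - x))"
        by (intro continuous_intros continuous_on_compose2[OF h]) auto
      show "\<forall>x. x \<in> {0..1/2} \<and> \<not> x \<le> 1/2 \<or> x \<in> {1/2..1} \<and> x \<le> 1/2 \<longrightarrow> h x = - h (1 - x)"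
      proof (intro allI impI)
        fix x :: real assume "x \<in> {0..1/2} \<and> \<not> x \<le> 1/2 \<or> x \<in> {1/2..1} \<and> x \<le> 1/2"
        then have "x = 1/2" by auto
        show "h x = - h (1 - x)" unfolding \<open>x = 1/2\<close> using zero by simp
      qed
    qed auto
    moreover have "{0..1/2} \<union> {1/2..1} = {0..1::real}" by auto
    ultimately show ?thesis by simp
  qed
  define G where "G = (\<lambda>y. H (arccos y / pi))"
  have "continuous_on {-1..1} G"
    unfolding G_def
    by (intro continuous_on_compose2[OF H] continuous_intros) (auto simp: arccos_lbound arccos_ubound)
  then obtain p where p: "real_polynomial_function p" and pG: "\<And>y. y \<in> {-1..1} \<Longrightarrow> \<bar>G y - p y\<bar> < \<epsilon>"
    using Stone_Weierstrass_real_polynomial_function[OF compact_Icc, of "-1" 1 G \<epsilon>] \<open>\<epsilon> > 0\<close> by blast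
  obtain a n where p_eq: "p = (\<lambda>y. \<Sum>i\<le>n. a i * y ^ i)"
    using p unfolding real_polynomial_function_iff_sum by blast
  \<comment> \<open>The odd part of \<open>p\<close>, evaluated at \<open>cos (pi * x)\<close>.\<close>
  define P where "P = (\<lambda>x. \<Sum>i\<le>n. (if odd i then a i else 0) * cos (pi * x) ^ i)"
  show ?thesis
  proof
    show "cos_poly P"
      unfolding P_def
    proof (rule cos_poly_sum)
      fix i
      show "cos_poly (\<lambda>x. (if odd i then a i else 0) * cos (pi * x) ^ i)"
        using cos_poly.scale[OF cos_poly_odd_power] cos_poly_zero by (cases "odd i") (auto elim!: oddE)
    qed simp
    fix x :: real assume x: "x \<in> {-1/2..1/2}"
    define y where "y = cos (pi * x)"
    have y: "y = cos (pi * \<bar>x\<bar>)" by (simp add: y_def abs_if)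
    have ac: "arccos y = pi * \<bar>x\<bar>" unfolding y using x by (intro arccos_cos) auto
    have y1: "-1 \<le> y" "y \<le> 1" by (auto simp: y_def)
    have hx: "h \<bar>x\<bar> = h x" using even[OF x] by (simp add: abs_if)
    have Gy: "G y = h x"
      using x hx by (auto simp: G_def ac H_def)
    have "arccos (- y) / pi = 1 - \<bar>x\<bar>"
      using arccos_minus[OF y1] ac by (simp add: diff_divide_distrib)
    then have "G (- y) = H (1 - \<bar>x\<bar>)" by (simp add: G_def)
    also have "\<dots> = - h x"
    proof (cases "\<bar>x\<bar> = 1/2")
      case True
      then show ?thesis using zero hx unfolding True by (simp add: H_def)
    next
      case False
      then show ?thesis using x hx by (auto simp: H_def)
    qed
    finally have Gy': "G (- y) = - h x" .
    have "p y - p (- y) = (\<Sum>i\<le>n. 2 * ((if odd i then a i else 0) * y ^ i))"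
      unfolding p_eq sum_subtractf[symmetric] by (intro sum.cong) auto
    then have "p y - p (- y) = 2 * P x"
      by (simp add: P_def y_def sum_distrib_left)
    moreover have "\<bar>G y - p y\<bar> < \<epsilon>" "\<bar>G (- y) - p (- y)\<bar> < \<epsilon>"
      using pG[of y] pG[of "- y"] y1 by auto
    ultimately show "\<bar>h x - P x\<bar> \<le> \<epsilon>" unfolding Gy Gy' by linarith
  qed
qed

lemma cos_poly_orthogonal:
  assumes "cos_poly P"
  shows "\<exists>N. \<forall>r. continuous_on {-1/2..1/2} r \<longrightarrow> (\<forall>k<N. L2_inner r (cos_mode k) = 0) \<longrightarrow> L2_inner r P = 0"
  using assms
proof (induction rule: cos_poly.induct)
  case (mode k)
  then show ?case by (intro exI[of _ "Suc k"]) auto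
next
  case (add p q)
  then obtain M N where
    "\<forall>r. continuous_on {-1/2..1/2} r \<longrightarrow> (\<forall>k<M. L2_inner r (cos_mode k) = 0) \<longrightarrow> L2_inner r p = 0"
    "\<forall>r. continuous_on {-1/2..1/2} r \<longrightarrow> (\<forall>k<N. L2_inner r (cos_mode k) = 0) \<longrightarrow> L2_inner r q = 0"
    by blast
  moreover have "L2_inner r (\<lambda>x. p x + q x) = L2_inner r p + L2_inner r q" if "continuous_on {-1/2..1/2} r" for r
    by (rule L2_inner_add_right[OF that]) (rule continuous_on_cos_poly add.hyps)+
  ultimately show ?case
    by (intro exI[of _ "max M N"]) simp
next
  case (scale p a)
  then show ?case by (auto simp: L2_inner_scale_right)
qed

text \<open>Best approximation: the remainder \<open>h - S N\<close> of the partial sum is orthogonal to all modes below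
\<open>N\<close>, hence to a given element \<open>P\<close> of the span once \<open>N\<close> is large, so its norm is at most that of
\<open>h - P\<close>. The function \<open>g\<close> enters only through its norm, so it may be nonzero at the endpoints.\<close>

lemma parseval_cos_mode:
  assumes h: "continuous_on {-1/2..1/2} h" and even: "\<And>x. x \<in> {-1/2..1/2} \<Longrightarrow> h (- x) = h x"
    and zero: "h (1/2) = 0" and g: "continuous_on {-1/2..1/2} g"
  shows "(\<lambda>k. 2 * L2_inner h (cos_mode k) * L2_inner (cos_mode k) g) sums L2_inner h g"
proof -
  define S where "S = (\<lambda>N x. \<Sum>k<N. 2 * L2_inner h (cos_mode k) * cos_mode k x)"
  have S_cont: "continuous_on {-1/2..1/2} (S N)" for N
    unfolding S_def by (intro continuous_intros)
  have L2_inner_S: "L2_inner (S N) q = (\<Sum>k<N. 2 * L2_inner h (cos_mode k) * L2_inner (cos_mode k) q)"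
    if "continuous_on {-1/2..1/2} q" for N q
    unfolding S_def using that
    by (subst L2_inner_sum_left) (auto intro: continuous_intros simp: L2_inner_scale_left)
  define r where "r = (\<lambda>N x. h x - S N x)"
  have r_cont: "continuous_on {-1/2..1/2} (r N)" for N
    unfolding r_def by (intro continuous_intros h S_cont)
  have r_orth: "L2_inner (r N) (cos_mode j) = 0" if "j < N" for N j
  proof -
    have "L2_inner (S N) (cos_mode j) = (\<Sum>k<N. if k = j then L2_inner h (cos_mode k) else 0)"
      unfolding L2_inner_S[OF continuous_on_cos_mode] by (intro sum.cong) (auto simp: L2_inner_cos_mode)
    also have "\<dots> = L2_inner h (cos_mode j)" using that by simp
    finally show ?thesis unfolding r_def
      by (simp add: L2_inner_diff_left[OF h S_cont continuous_on_cos_mode])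
  qed
  have r_S: "L2_inner (r N) (S N) = 0" for N
    unfolding L2_inner_commute[of "r N"] L2_inner_S[OF r_cont] using r_orth
    by (intro sum.neutral) (auto simp: L2_inner_commute)
  have "(\<lambda>N. L2_inner (S N) g) \<longlonglongrightarrow> L2_inner h g"
  proof (rule LIMSEQ_I)
    fix e :: real assume "e > 0"
    \<comment> \<open>Scaling \<open>g\<close> by this \<open>\<epsilon>\<close> in Young's inequality gives an error of at most \<open>e / 2\<close>.\<close>
    define \<epsilon> where "\<epsilon> = e / (1 + L2_inner g g)"
    have "L2_inner g g \<ge> 0" by (rule has_integral_nonneg[OF L2_inner_has_integral[OF g g]]) simp
    then have \<epsilon>: "\<epsilon> > 0" "\<epsilon> * (1 + L2_inner g g) = e" using \<open>e > 0\<close> by (auto simp: \<epsilon>_def)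
    obtain P where P: "cos_poly P" and Ph: "\<And>x. x \<in> {-1/2..1/2} \<Longrightarrow> \<bar>h x - P x\<bar> \<le> \<epsilon>"
      using cos_poly_dense[OF h even zero \<epsilon>(1)] by blast
    obtain N0 where N0: "\<And>r. continuous_on {-1/2..1/2} r \<Longrightarrow> (\<forall>k<N0. L2_inner r (cos_mode k) = 0) \<Longrightarrow> L2_inner r P = 0"
      using cos_poly_orthogonal[OF P] by blast
    note Pc = continuous_on_cos_poly[OF P, of "{-1/2..1/2}"]
    define d where "d = (\<lambda>x. h x - P x)"
    have dc: "continuous_on {-1/2..1/2} d" unfolding d_def by (intro continuous_intros h Pc)
    have dd: "L2_inner d d \<le> \<epsilon>\<^sup>2"
    proof -
      have "L2_inner d d \<le> L2_inner (\<lambda>_. \<epsilon>) (\<lambda>_. \<epsilon>)"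
      proof (rule L2_inner_mono)
        fix x :: real assume "x \<in> {-1/2..1/2}"
        then have "\<bar>d x\<bar> * \<bar>d x\<bar> \<le> \<epsilon> * \<epsilon>" using Ph \<epsilon> unfolding d_def by (intro mult_mono) auto
        then show "d x * d x \<le> \<epsilon> * \<epsilon>" by simp
      qed (rule dc continuous_on_const)+
      then show ?thesis by (simp add: L2_inner_def power2_eq_square)
    qed
    have "norm (L2_inner (S N) g - L2_inner h g) < e" if N: "N \<ge> N0" for N
    proof -
      have rP: "L2_inner (r N) P = 0" using N r_orth by (intro N0 r_cont) auto
      have "L2_inner (r N) (r N) = L2_inner (r N) h - L2_inner (r N) (S N)"
        using L2_inner_diff_right[OF r_cont h S_cont, of N N] by (simp add: r_def)
      also have "\<dots> = L2_inner (r N) d"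
        unfolding d_def by (simp add: L2_inner_diff_right[OF r_cont h Pc] rP r_S)
      finally have rr: "L2_inner (r N) (r N) \<le> \<epsilon>\<^sup>2"
        using L2_inner_young[OF r_cont dc, of N] dd by simp
      have bound: "2 * c * L2_inner (r N) g \<le> \<epsilon> * e" if "c = \<epsilon> \<or> c = - \<epsilon>" for c
      proof -
        have "2 * L2_inner (r N) (\<lambda>x. c * g x) \<le> L2_inner (r N) (r N) + L2_inner (\<lambda>x. c * g x) (\<lambda>x. c * g x)"
          by (intro L2_inner_young r_cont continuous_intros g)
        also have "L2_inner (\<lambda>x. c * g x) (\<lambda>x. c * g x) = \<epsilon>\<^sup>2 * L2_inner g g"
          unfolding L2_inner_scale_right L2_inner_scale_left using that by (auto simp: power2_eq_square)
        finally have "2 * L2_inner (r N) (\<lambda>x. c * g x) \<le> \<epsilon>\<^sup>2 + \<epsilon>\<^sup>2 * L2_inner g g" using rr by simp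
        also have "\<dots> = \<epsilon> * (\<epsilon> * (1 + L2_inner g g))" by (simp add: power2_eq_square algebra_simps)
        finally show ?thesis unfolding \<epsilon>(2) by (simp add: L2_inner_scale_right)
      qed
      have "\<epsilon> * (2 * L2_inner (r N) g) \<le> \<epsilon> * e" "\<epsilon> * (- (2 * L2_inner (r N) g)) \<le> \<epsilon> * e"
        using bound[of \<epsilon>] bound[of "-\<epsilon>"] by auto
      then have "2 * L2_inner (r N) g \<le> e" "- (2 * L2_inner (r N) g) \<le> e"
        using \<epsilon>(1) by (simp_all only: mult_le_cancel_left_pos)
      moreover have "L2_inner (r N) g = L2_inner h g - L2_inner (S N) g"
        unfolding r_def by (simp add: L2_inner_diff_left[OF h S_cont g])
      ultimately show ?thesis using \<open>e > 0\<close> by (simp add: abs_if)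
    qed
    then show "\<exists>no. \<forall>n\<ge>no. norm (L2_inner (S n) g - L2_inner h g) < e" by blast
  qed
  then show ?thesis by (simp add: sums_def L2_inner_S[OF g])
qed

section \<open>The cap and its coefficients\<close>

definition cap :: "real \<Rightarrow> real \<Rightarrow> real" where
  "cap \<alpha> x = 1 - \<bar>2 * x\<bar> powr \<alpha>"

lemma continuous_on_cap: "\<alpha> > 0 \<Longrightarrow> continuous_on A (cap \<alpha>)"
  unfolding cap_def by (intro continuous_intros continuous_on_powr') auto

lemma has_integral_abs_double:
  fixes F :: "real \<Rightarrow> real"
  assumes "(F has_integral c) {0..1}"
  shows "((\<lambda>x. F \<bar>2 * x\<bar>) has_integral c) {-1/2..1/2}"
proof -
  have img: "(\<lambda>x. (1 / 2) * x) ` {0..1::real} = {0..1/2}" "(\<lambda>x. (1 / (-2)) * x) ` {0..1::real} = {-1/2..0}"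
    using image_mult_atLeastAtMost_if[of "1/2" 0 1] image_mult_atLeastAtMost_if[of "-1/2" 0 1]
    by auto
  have "((\<lambda>x. F (2 * x)) has_integral c / 2) {0..1/2}"
    using has_integral_affinity[of F c 0 1 2 0] assms img by simp
  then have right: "((\<lambda>x. F \<bar>2 * x\<bar>) has_integral c / 2) {0..1/2}"
    by (rule has_integral_eq[rotated]) auto
  have "((\<lambda>x. F (- 2 * x)) has_integral c / 2) {-1/2..0}"
    using has_integral_affinity[of F c 0 1 "-2" 0] assms img by simp
  then have left: "((\<lambda>x. F \<bar>2 * x\<bar>) has_integral c / 2) {-1/2..0}"
    by (rule has_integral_eq[rotated]) auto
  show ?thesis
    using has_integral_combine[OF _ _ left right] by simp
qed

lemma L2_inner_cap_cos_mode:
  assumes "\<alpha> > 0"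
  shows "L2_inner (cap \<alpha>) (cos_mode k)
    = integral {0..1} (\<lambda>t. (1 - t powr \<alpha>) * cos ((2 * real k + 1) * pi / 2 * t))"
proof -
  let ?F = "\<lambda>t. (1 - t powr \<alpha>) * cos ((2 * real k + 1) * pi / 2 * t)"
  have "(?F has_integral integral {0..1} ?F) {0..1}" using assms
    by (intro integrable_integral integrable_continuous_real continuous_intros continuous_on_powr') auto
  from has_integral_abs_double[OF this] show ?thesis
    unfolding L2_inner_def
  proof (intro integral_unique, elim has_integral_eq[rotated])
    fix x :: real
    have "cos ((2 * real k + 1) * pi / 2 * \<bar>2 * x\<bar>) = cos ((2 * real k + 1) * pi * x)"
      by (cases "x \<ge> 0") (simp_all add: abs_if mult.assoc)
    then show "?F \<bar>2 * x\<bar> = cap \<alpha> x * cos_mode k x" by (simp add: cap_def cos_mode_def)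
  qed
qed

lemma has_integral_abs_double_powr:
  fixes \<alpha> :: real
  assumes "\<alpha> > 0"
  shows "((\<lambda>x. \<bar>2 * x\<bar> powr \<alpha>) has_integral 1 / (\<alpha> + 1)) {-1/2..1/2}"
  using has_integral_abs_double[OF has_integral_powr_from_0[of \<alpha> 1]] assms by simp

lemma L2_inner_cap_one:
  assumes "\<alpha> > 0"
  shows "L2_inner (cap \<alpha>) (\<lambda>_. 1) = \<alpha> / (\<alpha> + 1)"
proof -
  have "((\<lambda>x. 1 - \<bar>2 * x\<bar> powr \<alpha>) has_integral 1 - 1 / (\<alpha> + 1)) {-1/2..1/2}"
    using has_integral_diff[OF has_integral_const_real[of "1::real" "-1/2" "1/2"] has_integral_abs_double_powr[OF assms]]
    by simp
  then show ?thesis using assms by (simp add: L2_inner_def cap_def integral_unique field_simps)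
qed

lemma sin_odd_half_pi: "sin ((2 * real k + 1) * pi / 2) = (-1) ^ k"
  and cos_odd_half_pi: "cos ((2 * real k + 1) * pi / 2) = 0"
proof -
  have e: "(2 * real k + 1) * pi / 2 = real k * pi + pi / 2" by (simp add: field_simps)
  show "sin ((2 * real k + 1) * pi / 2) = (-1) ^ k" "cos ((2 * real k + 1) * pi / 2) = 0"
    unfolding e sin_add cos_add by simp_all
qed

lemma L2_inner_cos_mode_one: "L2_inner (cos_mode k) (\<lambda>_. 1) = (-1) ^ k / (pi * (real k + 1/2))"
proof -
  define a where "a = (2 * real k + 1) * pi"
  have a: "a > 0" by (simp add: a_def add_nonneg_pos)
  have "((\<lambda>x. cos (a * x)) has_integral sin (a * (1/2)) / a - sin (a * (-1/2)) / a) {-1/2..1/2::real}"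
  proof (rule fundamental_theorem_of_calculus)
    fix x :: real
    show "((\<lambda>x. sin (a * x) / a) has_vector_derivative cos (a * x)) (at x within {-1/2..1/2})"
      unfolding has_real_derivative_iff_has_vector_derivative[symmetric]
      using a by (auto intro!: derivative_eq_intros)
  qed simp
  moreover have "sin (a * (1/2)) = (-1) ^ k" using sin_odd_half_pi[of k] by (simp add: a_def)
  ultimately have "((\<lambda>x. cos (a * x)) has_integral 2 * ((-1) ^ k / a)) {-1/2..1/2::real}"
    by simp
  moreover have "2 * ((-1) ^ k / a) = (-1) ^ k / (pi * (real k + 1/2))"
    by (simp add: a_def divide_simps)
  ultimately show ?thesis by (simp add: L2_inner_def cos_mode_def a_def integral_unique)
qed

text \<open>An alternating sign pattern forces \<open>\<alpha> \<ge> 2\<close>: the second coefficient is positive when \<open>\<alpha> \<le> 1\<close>, and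
for \<open>1 < \<alpha> < 2\<close> the coefficients of high odd index are positive.\<close>

lemma cap_coeff_alternating_imp_ge_2:
  assumes \<alpha>: "\<alpha> > 0" and alt: "\<And>k. (-1) ^ k * L2_inner (cap \<alpha>) (cos_mode k) \<ge> 0"
  shows "\<alpha> \<ge> 2"
proof (rule ccontr)
  assume "\<not> \<alpha> \<ge> 2"
  define \<omega> where "\<omega> = (\<lambda>k. (2 * real k + 1) * pi / 2)"
  have \<omega>1: "\<omega> k \<ge> real k + 1" for k
  proof -
    have "(2 * real k + 1) * 2 \<le> (2 * real k + 1) * pi" using pi_ge_two by (intro mult_left_mono) auto
    then show ?thesis by (simp add: \<omega>_def)
  qed
  have \<omega>0: "\<omega> k > 0" for k using \<omega>1[of k] by linarith
  interpret quarter_wave \<alpha> "\<omega> k" "L2_inner (cap \<alpha>) (cos_mode k)" for k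
  proof unfold_locales
    show "cos (\<omega> k) = 0" unfolding \<omega>_def by (rule cos_odd_half_pi)
    show "L2_inner (cap \<alpha>) (cos_mode k) \<equiv> integral {0..1} (\<lambda>t. (1 - t powr \<alpha>) * cos (\<omega> k * t))"
      unfolding \<omega>_def by (rule eq_reflection) (rule L2_inner_cap_cos_mode[OF \<alpha>])
  qed (rule \<alpha> \<omega>0)+
  have odd: "L2_inner (cap \<alpha>) (cos_mode k) \<le> 0" if "odd k" for k using alt[of k] that by simp
  have "\<alpha> > 1" using coeff_pos_if_le_1[of 1] odd[of 1] by force
  then have \<alpha>12: "1 < \<alpha>" "\<alpha> < 2" using \<open>\<not> \<alpha> \<ge> 2\<close> by auto
  define C where "C = 4 * (\<alpha> - 1) / ((2 - \<alpha>) * (3 - \<alpha>))"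
  have C: "C > 0" using \<alpha>12 by (simp add: C_def)
  obtain n :: nat where n: "real n > C powr (1 / (2 - \<alpha>))" using reals_Archimedean2 by blast
  \<comment> \<open>An odd index, so that \<open>sin (\<omega> k) = -1\<close>.\<close>
  define k where "k = 2 * n + 1"
  have "sin (\<omega> k) = -1" using sin_odd_half_pi[of k] by (simp add: \<omega>_def k_def)
  then have "\<omega> k powr (2 - \<alpha>) \<le> C"
    unfolding C_def using \<omega>1[of k]
    by (intro coeff_lower_bound_if_between_1_2 \<alpha>12 odd) (auto simp: k_def)
  moreover have "(C powr (1 / (2 - \<alpha>))) powr (2 - \<alpha>) < \<omega> k powr (2 - \<alpha>)"
    using n \<omega>1[of k] \<alpha>12 by (intro powr_less_mono2) (auto simp: k_def)
  ultimately show False using C \<alpha>12 by (simp add: powr_powr)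
qed

lemma cap_coeff_strictly_alternating:
  assumes "\<alpha> \<ge> 2"
  shows "(-1) ^ k * L2_inner (cap \<alpha>) (cos_mode k) > 0"
proof -
  define \<omega> where "\<omega> = (2 * real k + 1) * pi / 2"
  have "(2 * real k + 1) * 2 \<le> (2 * real k + 1) * pi" using pi_ge_two by (intro mult_left_mono) auto
  then have \<omega>1: "\<omega> \<ge> 1" by (simp add: \<omega>_def)
  interpret quarter_wave \<alpha> \<omega> "L2_inner (cap \<alpha>) (cos_mode k)"
  proof unfold_locales
    show "cos \<omega> = 0" unfolding \<omega>_def by (rule cos_odd_half_pi)
    show "L2_inner (cap \<alpha>) (cos_mode k) \<equiv> integral {0..1} (\<lambda>t. (1 - t powr \<alpha>) * cos (\<omega> * t))"
      unfolding \<omega>_def by (rule eq_reflection) (rule L2_inner_cap_cos_mode, use assms in simp)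
  qed (use assms \<omega>1 in auto)
  show ?thesis using coeff_sign_if_ge_2[OF assms \<omega>1] sin_odd_half_pi[of k] by (simp add: \<omega>_def)
qed

lemma parseval_cap:
  assumes "\<alpha> > 0" "continuous_on {-1/2..1/2} g"
  shows "(\<lambda>k. 2 * L2_inner (cap \<alpha>) (cos_mode k) * L2_inner (cos_mode k) g) sums L2_inner (cap \<alpha>) g"
  by (rule parseval_cos_mode[OF continuous_on_cap[OF assms(1)] _ _ assms(2)]) (simp_all add: cap_def)

lemma continuous_on_Icc_obtain_bound:
  fixes g :: "real \<Rightarrow> real"
  assumes "continuous_on {a..b} g"
  obtains B where "\<And>x. x \<in> {a..b} \<Longrightarrow> \<bar>g x\<bar> \<le> B"
  using compact_imp_bounded[OF compact_continuous_image[OF assms compact_Icc]]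
  unfolding bounded_iff by (auto simp only: image_iff ball_simps real_norm_def)

text \<open>The constant \<open>1\<close> does not vanish at the endpoints, but it is the limit of the functions
\<open>cap n\<close>, which do: the difference \<open>\<bar>2 * x\<bar> powr n\<close> has integral \<open>1 / (n + 1)\<close>.\<close>

lemma integral_zero_if_orthogonal:
  assumes g: "continuous_on {-1/2..1/2} g" and orth: "\<And>k. L2_inner (cos_mode k) g = 0"
  shows "integral {-1/2..1/2} g = 0"
proof -
  obtain B where B: "\<And>x. x \<in> {-1/2..1/2} \<Longrightarrow> \<bar>g x\<bar> \<le> B"
    using continuous_on_Icc_obtain_bound[OF g] by blast
  have int_g: "(g has_integral integral {-1/2..1/2} g) {-1/2..1/2}"
    by (intro integrable_integral integrable_continuous_real g)
  have bound: "\<bar>integral {-1/2..1/2} g\<bar> \<le> B * (1 / (real (Suc n) + 1))" for n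
  proof -
    let ?\<alpha> = "real (Suc n)"
    have cap0: "L2_inner (cap ?\<alpha>) g = 0"
      using sums_unique2[OF parseval_cap[of ?\<alpha>, OF _ g]] orth by simp
    have "((\<lambda>x. cap ?\<alpha> x * g x) has_integral L2_inner (cap ?\<alpha>) g) {-1/2..1/2}"
      by (intro L2_inner_has_integral continuous_on_cap g) simp
    from has_integral_diff[OF int_g this[unfolded cap0]]
    have A: "((\<lambda>x. \<bar>2 * x\<bar> powr ?\<alpha> * g x) has_integral integral {-1/2..1/2} g) {-1/2..1/2}"
      by (simp add: cap_def algebra_simps)
    have D: "((\<lambda>x. B * \<bar>2 * x\<bar> powr ?\<alpha>) has_integral B * (1 / (?\<alpha> + 1))) {-1/2..1/2}"
      by (intro has_integral_mult_right has_integral_abs_double_powr) simp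
    have le: "\<bar>\<bar>2 * x\<bar> powr ?\<alpha> * g x\<bar> \<le> B * \<bar>2 * x\<bar> powr ?\<alpha>" if "x \<in> {-1/2..1/2}" for x
      using mult_left_mono[OF B[OF that], of "\<bar>2 * x\<bar> powr ?\<alpha>"] by (simp add: abs_mult mult.commute)
    have "integral {-1/2..1/2} g \<le> B * (1 / (?\<alpha> + 1))"
      by (rule has_integral_le[OF A D]) (use le in \<open>force simp: abs_le_iff\<close>)
    moreover have "- integral {-1/2..1/2} g \<le> B * (1 / (?\<alpha> + 1))"
      by (rule has_integral_le[OF has_integral_neg[OF A] D]) (use le in \<open>force simp: abs_le_iff\<close>)
    ultimately show ?thesis by simp
  qed
  have "(\<lambda>n. B * (1 / (real (Suc n) + 1))) \<longlonglongrightarrow> 0"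
    using tendsto_mult_right_zero[OF LIMSEQ_ignore_initial_segment[OF lim_1_over_n, of 2], of B]
    by (simp add: add_ac)
  from LIMSEQ_le_const[OF this] bound have "\<bar>integral {-1/2..1/2} g\<bar> \<le> 0" by blast
  then show ?thesis by simp
qed

section \<open>The equality case\<close>

text \<open>The heart of the matter. The factor \<open>(-1) ^ k * (real k + 1/2)\<close> is chosen such that \<open>pi * m k\<close> is
\<open>1\<close> for every \<open>k\<close> when \<open>f\<close> is the constant \<open>1\<close>. If all \<open>pi * m k\<close> are at most \<open>s\<close>, then the modes
of \<open>g = s - f\<close> have the signs of the coefficients of \<open>cap \<alpha>\<close>, so that all terms of the series for
the pairing of \<open>cap \<alpha>\<close> with \<open>g\<close> are nonnegative. The value of \<open>s\<close> makes this pairing zero. As no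
coefficient of \<open>cap \<alpha>\<close> vanishes, \<open>g\<close> is orthogonal to all modes, and its integral is zero.\<close>

lemma mode_dichotomy:
  assumes \<alpha>: "\<alpha> > 0" and alt: "\<And>k. (-1) ^ k * L2_inner (cap \<alpha>) (cos_mode k) > 0"
    and f: "continuous_on {-1/2..1/2} f"
  defines "m \<equiv> \<lambda>k. (-1) ^ k * (real k + 1/2) * L2_inner f (cos_mode k)"
    and "s \<equiv> (\<alpha> + 1) / \<alpha> * L2_inner (cap \<alpha>) f"
  shows "(\<exists>k. pi * m k > s) \<or> ((\<forall>k. pi * m k = s) \<and> integral {-1/2..1/2} f = s)"
proof (cases "\<exists>k. pi * m k > s")
  case False
  then have le: "pi * m k \<le> s" for k by (simp add: not_less)
  define g where "g = (\<lambda>x. s * 1 - f x)"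
  have g: "continuous_on {-1/2..1/2} g" unfolding g_def by (intro continuous_intros f)
  note c1 = continuous_on_const[of "{-1/2..1/2::real}" "s * 1::real"]
  have sign2: "(-1::real) ^ k * (-1) ^ k = 1" for k
    by (simp add: power_mult_distrib[symmetric])
  have mode_g: "(-1) ^ k * L2_inner (cos_mode k) g = (s - pi * m k) / (pi * (real k + 1/2))" for k
  proof -
    have "L2_inner (cos_mode k) g = s * L2_inner (cos_mode k) (\<lambda>_. 1) - L2_inner f (cos_mode k)"
      unfolding g_def using L2_inner_diff_right[OF continuous_on_cos_mode c1 f, of k]
        L2_inner_scale_right[of "cos_mode k" s "\<lambda>_. 1"] by (simp add: L2_inner_commute[of f])
    also have "\<dots> = s * ((-1) ^ k / (pi * (real k + 1/2))) - L2_inner f (cos_mode k)"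
      by (simp only: L2_inner_cos_mode_one)
    finally have "(-1) ^ k * L2_inner (cos_mode k) g
        = s * ((-1) ^ k * (-1) ^ k) / (pi * (real k + 1/2)) - (-1) ^ k * L2_inner f (cos_mode k)"
      by (simp add: right_diff_distrib mult_ac)
    also have "\<dots> = (s - pi * m k) / (pi * (real k + 1/2))"
      unfolding sign2 m_def by (simp add: divide_simps) (simp add: algebra_simps)
    finally show ?thesis .
  qed
  have mode_g_nonneg: "(-1) ^ k * L2_inner (cos_mode k) g \<ge> 0" for k
    unfolding mode_g using le[of k] by (intro divide_nonneg_nonneg) auto
  have "L2_inner (cap \<alpha>) g = s * L2_inner (cap \<alpha>) (\<lambda>_. 1) - L2_inner (cap \<alpha>) f"
    unfolding g_def using L2_inner_diff_right[OF continuous_on_cap[OF \<alpha>] c1 f]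
        L2_inner_scale_right[of "cap \<alpha>" s "\<lambda>_. 1"] by simp
  also have "\<dots> = 0" using \<alpha> by (simp add: L2_inner_cap_one s_def)
  finally have sums: "(\<lambda>k. 2 * L2_inner (cap \<alpha>) (cos_mode k) * L2_inner (cos_mode k) g) sums 0"
    using parseval_cap[OF \<alpha> g] by simp
  have nonneg: "2 * L2_inner (cap \<alpha>) (cos_mode k) * L2_inner (cos_mode k) g \<ge> 0" for k
  proof -
    have "0 \<le> ((-1) ^ k * L2_inner (cap \<alpha>) (cos_mode k)) * ((-1) ^ k * L2_inner (cos_mode k) g)"
      by (rule mult_nonneg_nonneg[OF less_imp_le[OF alt] mode_g_nonneg])
    also have "\<dots> = ((-1) ^ k * (-1) ^ k) * (L2_inner (cap \<alpha>) (cos_mode k) * L2_inner (cos_mode k) g)"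
      by (simp only: mult_ac)
    finally show ?thesis unfolding sign2 by (simp add: mult.commute)
  qed
  have "\<forall>k. 2 * L2_inner (cap \<alpha>) (cos_mode k) * L2_inner (cos_mode k) g = 0"
    using suminf_eq_zero_iff[OF sums_summable[OF sums] nonneg] sums_unique[OF sums] by simp
  then have orth: "L2_inner (cos_mode k) g = 0" for k
    using less_imp_neq[OF alt[of k]] by (auto dest: spec[of _ k])
  have "pi * m k = s" for k
    using mode_g[of k] by (simp add: orth add_nonneg_pos)
  moreover have "integral {-1/2..1/2} f = s"
  proof -
    have "(g has_integral s * 1 - integral {-1/2..1/2} f) {-1/2..1/2}"
      unfolding g_def
      using has_integral_diff[OF has_integral_const_real[of "s * 1" "-1/2" "1/2"]
          integrable_integral[OF integrable_continuous_real[OF f]]] by simp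
    then show ?thesis using integral_zero_if_orthogonal[OF g orth] by (simp add: integral_unique)
  qed
  ultimately show ?thesis by blast
qed blast

section \<open>Fourier transforms and norms of functions on the interval\<close>

lemma set_integrable_continuous_Icc:
  fixes w :: "real \<Rightarrow> 'a::euclidean_space"
  assumes "continuous_on {-1/2..1/2} w"
  shows "set_integrable lborel {-1/2..1/2} w"
  unfolding set_integrable_def by (rule borel_integrable_compact[OF compact_Icc assms])

lemma fourier_zero_ext:
  assumes v: "continuous_on {-1/2..1/2} v"
  shows "((\<lambda>x. complex_of_real (v x) * exp (- 2 * complex_of_real pi * \<i> * of_real \<xi> * of_real x))
    has_integral fourier (zero_ext v) \<xi>) {-1/2..1/2}"
proof -
  let ?w = "\<lambda>x. complex_of_real (v x) * exp (- 2 * complex_of_real pi * \<i> * of_real \<xi> * of_real x)"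
  have w: "continuous_on {-1/2..1/2} ?w" by (intro continuous_intros v)
  note int = set_integrable_continuous_Icc[OF w]
  have "fourier (zero_ext v) \<xi> = (LINT x : {-1/2..1/2} | lborel. ?w x)"
    unfolding fourier_def set_lebesgue_integral_def
    by (rule Bochner_Integration.integral_cong) (simp_all add: zero_ext_def)
  then show ?thesis using set_borel_integral_eq_integral[OF int] by (simp add: integrable_integral)
qed

lemma Re_fourier_zero_ext:
  assumes v: "continuous_on {-1/2..1/2} v"
  shows "Re (fourier (zero_ext v) \<xi>) = L2_inner v (\<lambda>x. cos (2 * pi * \<xi> * x))"
proof -
  have eq: "Re (complex_of_real (v x) * exp (- 2 * complex_of_real pi * \<i> * of_real \<xi> * of_real x))
      = v x * cos (2 * pi * \<xi> * x)" for x
    by (simp add: Re_exp)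
  have "((\<lambda>x. v x * cos (2 * pi * \<xi> * x)) has_integral Re (fourier (zero_ext v) \<xi>)) {-1/2..1/2}"
    using has_integral_linear[OF fourier_zero_ext[OF v, of \<xi>] bounded_linear_Re]
    unfolding o_def eq .
  then show ?thesis unfolding L2_inner_def by (rule integral_unique[symmetric])
qed

text \<open>The transform of the indicator, multiplied by the frequency so that no division by zero occurs at
\<open>\<xi> = 0\<close>.\<close>

lemma times_fourier_one: "of_real \<xi> * fourier (zero_ext (\<lambda>_. 1)) \<xi> = of_real (sin (pi * \<xi>) / pi)"
proof -
  define c where "c = - 2 * complex_of_real pi * \<i> * of_real \<xi>"
  define E where "E = (\<lambda>x::real. \<i> / (2 * of_real pi) * exp (of_real x * c))"
  have c: "\<i> / (2 * of_real pi) * c = of_real \<xi>" by (simp add: c_def)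
  have "((\<lambda>x. of_real \<xi> * exp (- 2 * complex_of_real pi * \<i> * of_real \<xi> * of_real x))
     has_integral E (1/2) - E (-1/2)) {-1/2..1/2}"
  proof (rule fundamental_theorem_of_calculus)
    fix x :: real
    have "((\<lambda>z. \<i> / (2 * of_real pi) * exp (z * c)) has_field_derivative
        \<i> / (2 * of_real pi) * (exp (of_real x * c) * c)) (at (of_real x))"
      by (auto intro!: derivative_eq_intros)
    also have "\<i> / (2 * of_real pi) * (exp (of_real x * c) * c) = of_real \<xi> * exp (of_real x * c)"
      unfolding c[symmetric] by simp
    also have "of_real x * c = - 2 * complex_of_real pi * \<i> * of_real \<xi> * of_real x"
      by (simp add: c_def)
    finally show "(E has_vector_derivative of_real \<xi> * exp (- 2 * complex_of_real pi * \<i> * of_real \<xi> * of_real x))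
       (at x within {-1/2..1/2})"
      unfolding E_def by (rule has_vector_derivative_real_field)
  qed simp
  moreover have "((\<lambda>x. of_real \<xi> * (complex_of_real 1 * exp (- 2 * complex_of_real pi * \<i> * of_real \<xi> * of_real x)))
     has_integral of_real \<xi> * fourier (zero_ext (\<lambda>_. 1)) \<xi>) {-1/2..1/2}"
    by (intro has_integral_mult_right fourier_zero_ext continuous_intros)
  ultimately have "of_real \<xi> * fourier (zero_ext (\<lambda>_. 1)) \<xi> = E (1/2) - E (-1/2)"
    unfolding of_real_1 mult_1 by (rule has_integral_unique[rotated])
  also have "E (1/2) = \<i> / (2 * of_real pi) * cis (- (pi * \<xi>))"
    by (simp add: E_def c_def cis_conv_exp mult_ac)
  also have "E (-1/2) = \<i> / (2 * of_real pi) * cis (pi * \<xi>)"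
    by (simp add: E_def c_def cis_conv_exp mult_ac)
  also have "\<i> / (2 * of_real pi) * cis (- (pi * \<xi>)) - \<i> / (2 * of_real pi) * cis (pi * \<xi>)
      = of_real (sin (pi * \<xi>) / pi)"
    by (simp add: complex_eq_iff Re_divide Im_divide power2_eq_square)
  finally show ?thesis .
qed

lemma Linf_norm_one_le:
  "Linf_norm (\<lambda>\<xi>. of_real \<xi> * fourier (zero_ext (\<lambda>_. 1)) \<xi>) \<le> ennreal (1 / pi)"
  unfolding Linf_norm_def times_fourier_one
  by (rule esssup_I) (auto intro!: ennreal_leI divide_right_mono simp: norm_divide)

text \<open>The real part of the weighted transform depends continuously on the frequency, so the essential
supremum bounds it at every single frequency: a set where it is exceeded would be open and
nonempty, hence of positive measure.\<close>

lemma Linf_norm_ge_Re: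
  assumes v: "continuous_on {-1/2..1/2} v"
  shows "ennreal \<bar>\<xi> * L2_inner v (\<lambda>x. cos (2 * pi * \<xi> * x))\<bar>
    \<le> Linf_norm (\<lambda>\<xi>. of_real \<xi> * fourier (zero_ext v) \<xi>)" (is "_ \<le> ?L")
proof (rule ccontr)
  define \<Phi> where "\<Phi> = (\<lambda>\<xi>. \<bar>\<xi> * L2_inner v (\<lambda>x. cos (2 * pi * \<xi> * x))\<bar>)"
  assume "\<not> ennreal \<bar>\<xi> * L2_inner v (\<lambda>x. cos (2 * pi * \<xi> * x))\<bar> \<le> ?L"
  then have lt: "?L < ennreal (\<Phi> \<xi>)" by (simp add: \<Phi>_def not_le)
  have "continuous_on (UNIV \<times> cbox (-1/2) (1/2)) (\<lambda>(\<xi>, x). v x * cos (2 * pi * \<xi> * x))"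
    by (auto simp: case_prod_beta intro!: continuous_intros continuous_on_compose2[OF v])
  then have "continuous_on UNIV (\<lambda>\<xi>. L2_inner v (\<lambda>x. cos (2 * pi * \<xi> * x)))"
    unfolding L2_inner_def using integral_continuous_on_param[of UNIV "-1/2" "1/2::real" "\<lambda>\<xi> x. v x * cos (2 * pi * \<xi> * x)"] by simp
  then have cont: "continuous_on UNIV \<Phi>" unfolding \<Phi>_def by (intro continuous_intros)
  obtain C where C: "?L = ennreal C" "C \<ge> 0" using lt by (cases ?L) (auto simp: top_unique)
  define U where "U = {\<xi>. C < \<Phi> \<xi>}"
  have "open U" unfolding U_def by (rule open_Collect_less[OF continuous_on_const cont])
  moreover have "\<xi> \<in> U" using lt C by (simp add: U_def ennreal_less_iff)
  ultimately have "\<not> negligible U" using open_not_negligible by blast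
  moreover have "negligible U"
  proof -
    have "AE \<xi> in lborel. ennreal (cmod (of_real \<xi> * fourier (zero_ext v) \<xi>)) \<le> ?L"
      unfolding Linf_norm_def by (rule esssup_AE)
    then have "AE \<xi> in lborel. \<xi> \<notin> U"
    proof (rule AE_mp, intro always_eventually allI impI)
      fix \<xi>
      assume "ennreal (cmod (of_real \<xi> * fourier (zero_ext v) \<xi>)) \<le> ?L"
      then have "cmod (of_real \<xi> * fourier (zero_ext v) \<xi>) \<le> C" using C by (simp add: ennreal_le_iff)
      moreover have "\<Phi> \<xi> \<le> cmod (of_real \<xi> * fourier (zero_ext v) \<xi>)"
        using abs_Re_le_cmod[of "fourier (zero_ext v) \<xi>"]
        by (simp add: \<Phi>_def Re_fourier_zero_ext[OF v] norm_mult abs_mult mult_left_mono)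
      ultimately show "\<xi> \<notin> U" by (simp add: U_def)
    qed
    then have "AE \<xi> in lebesgue. \<xi> \<notin> U" by (rule AE_completion)
    then show ?thesis
      by (simp add: negligible_iff_null_sets AE_iff_null_sets \<open>open U\<close> borel_open)
  qed
  ultimately show False by simp
qed

lemma L1_norm_zero_ext:
  assumes w: "continuous_on {-1/2..1/2} w" and nonneg: "\<And>x. x \<in> {-1/2..1/2} \<Longrightarrow> w x \<ge> 0"
  shows "L1_norm (zero_ext w) = ennreal (integral {-1/2..1/2} w)"
proof -
  have eq: "zero_ext w = (\<lambda>x. indicator {-1/2..1/2} x *\<^sub>R w x)"
    by (auto simp: zero_ext_def fun_eq_iff)
  have "integrable lborel (zero_ext w)"
    using set_integrable_continuous_Icc[OF w] unfolding set_integrable_def eq .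
  moreover have "zero_ext w x \<ge> 0" for x using nonneg by (simp add: zero_ext_def)
  ultimately have "L1_norm (zero_ext w) = ennreal (LINT x|lborel. zero_ext w x)"
    unfolding L1_norm_def by (simp add: nn_integral_eq_integral)
  also have "(LINT x|lborel. zero_ext w x) = integral {-1/2..1/2} w"
    using set_borel_integral_eq_integral(2)[OF set_integrable_continuous_Icc[OF w]]
    unfolding eq set_lebesgue_integral_def .
  finally show ?thesis .
qed

section \<open>The functional near the indicator\<close>

lemma ennreal_powr_mono: "a \<le> b \<Longrightarrow> p > 0 \<Longrightarrow> ennreal_powr a p \<le> ennreal_powr b p"
  unfolding ennreal_powr_def
  by (auto simp: top_unique intro!: ennreal_leI powr_mono2 enn2real_mono simp: less_top)

lemma ennreal_powr_ennreal: "a \<ge> 0 \<Longrightarrow> ennreal_powr (ennreal a) p = ennreal (a powr p)"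
  by (simp add: ennreal_powr_def)

lemma indicator_eq_zero_ext: "(indicator {-1/2..1/2} :: real \<Rightarrow> real) = zero_ext (\<lambda>_. 1)"
  by (auto simp: zero_ext_def fun_eq_iff)

lemma abs_powr_eq_abs_double_powr: "\<bar>x\<bar> powr \<alpha> = (1 / 2) powr \<alpha> * \<bar>2 * x\<bar> powr \<alpha>" for x \<alpha> :: real
  using powr_mult[of "1 / 2" "\<bar>2 * x\<bar>" \<alpha>] by (simp add: abs_mult)

lemma J_indicator_le:
  assumes "\<alpha> > 0"
  shows "J \<alpha> (indicator {-1/2..1/2}) \<le> ennreal ((1 / pi) powr \<alpha> * ((1 / 2) powr \<alpha> / (\<alpha> + 1)))"
proof -
  have "((\<lambda>x. (1 / 2) powr \<alpha> * \<bar>2 * x\<bar> powr \<alpha>) has_integral (1 / 2) powr \<alpha> * (1 / (\<alpha> + 1))) {-1/2..1/2}"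
    by (intro has_integral_mult_right has_integral_abs_double_powr assms)
  then have int: "integral {-1/2..1/2} (\<lambda>x. \<bar>x\<bar> powr \<alpha>) = (1 / 2) powr \<alpha> / (\<alpha> + 1)"
    unfolding abs_powr_eq_abs_double_powr[symmetric] by (simp add: integral_unique)
  have eq: "(\<lambda>x. \<bar>x\<bar> powr \<alpha> * zero_ext (\<lambda>_. 1) x) = zero_ext (\<lambda>x. \<bar>x\<bar> powr \<alpha>)"
    by (auto simp: zero_ext_def fun_eq_iff)
  have cont: "continuous_on {-1/2..1/2} (\<lambda>x::real. \<bar>x\<bar> powr \<alpha>)"
    using assms by (intro continuous_intros continuous_on_powr') auto
  have weight: "L1_norm (\<lambda>x. \<bar>x\<bar> powr \<alpha> * zero_ext (\<lambda>_. 1) x) = ennreal ((1 / 2) powr \<alpha> / (\<alpha> + 1))"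
    unfolding eq by (subst L1_norm_zero_ext[OF cont]) (simp_all only: int powr_ge_zero)
  have mass: "L1_norm (zero_ext (\<lambda>_. 1)) = 1"
    by (subst L1_norm_zero_ext) simp_all
  have "ennreal_powr (Linf_norm (\<lambda>\<xi>. of_real \<xi> * fourier (zero_ext (\<lambda>_. 1)) \<xi>)) \<alpha>
      \<le> ennreal ((1 / pi) powr \<alpha>)"
    using ennreal_powr_mono[OF Linf_norm_one_le assms] by (simp add: ennreal_powr_ennreal)
  then have "J \<alpha> (zero_ext (\<lambda>_. 1)) \<le> ennreal ((1 / pi) powr \<alpha>) * ennreal ((1 / 2) powr \<alpha> / (\<alpha> + 1))"
    unfolding J_def weight mass using ennreal_powr_ennreal[of 1 "\<alpha> + 1"]
    by (simp add: mult_right_mono divide_ennreal_def)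
  then show ?thesis using assms unfolding indicator_eq_zero_ext by (simp add: ennreal_mult[symmetric])
qed

text \<open>Both sides agree at \<open>\<epsilon> = 0\<close>, with slopes \<open>(\<alpha> + 1) * F\<close> and \<open>\<alpha> * q + t\<close>. When the slopes agree the
left side would win to second order, since the logarithm is concave, unless \<open>q\<close>, \<open>t\<close> and \<open>F\<close>
coincide; in that case both sides are equal.\<close>

lemma first_order_comparison:
  fixes \<alpha> q t F :: real
  assumes "\<alpha> > 0" and cases: "\<alpha> * q + t > (\<alpha> + 1) * F \<or> (q = F \<and> t = F)"
  shows "\<exists>\<epsilon>0>0. \<forall>\<epsilon>. 0 < \<epsilon> \<and> \<epsilon> < \<epsilon>0 \<longrightarrow> 1 + \<epsilon> * q > 0 \<and> 1 + \<epsilon> * t > 0 \<and> 1 + \<epsilon> * F > 0 \<and>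
    (1 + \<epsilon> * F) powr (\<alpha> + 1) \<le> (1 + \<epsilon> * q) powr \<alpha> * (1 + \<epsilon> * t)"
proof -
  define B where "B = \<bar>q\<bar> + \<bar>t\<bar> + \<bar>F\<bar> + 1"
  have pos: "1 + \<epsilon> * y > 0" if "0 < \<epsilon>" "\<epsilon> < 1 / B" "\<bar>y\<bar> \<le> B" for \<epsilon> y
  proof -
    have "B > 0" by (simp add: B_def)
    have "\<bar>\<epsilon> * y\<bar> \<le> \<epsilon> * B" using that by (simp add: abs_mult)
    also have "\<dots> < 1" using that \<open>B > 0\<close> by (simp add: field_simps)
    finally show ?thesis by linarith
  qed
  have B: "1 / B > 0" "\<bar>q\<bar> \<le> B" "\<bar>t\<bar> \<le> B" "\<bar>F\<bar> \<le> B" by (auto simp: B_def)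
  obtain d where d: "d > 0" "\<And>\<epsilon>. 0 < \<epsilon> \<Longrightarrow> \<epsilon> < d \<Longrightarrow> \<epsilon> < 1 / B \<Longrightarrow>
      (1 + \<epsilon> * F) powr (\<alpha> + 1) \<le> (1 + \<epsilon> * q) powr \<alpha> * (1 + \<epsilon> * t)"
  proof (cases "q = F \<and> t = F")
    case True
    show ?thesis
    proof (rule that[of 1])
      fix \<epsilon> :: real assume "0 < \<epsilon>" "\<epsilon> < 1 / B"
      then have "1 + \<epsilon> * F > 0" using pos B by blast
      then show "(1 + \<epsilon> * F) powr (\<alpha> + 1) \<le> (1 + \<epsilon> * q) powr \<alpha> * (1 + \<epsilon> * t)"
        using True by (simp add: powr_add)
    qed simp
  next
    case False
    define \<phi> where "\<phi> = (\<lambda>\<epsilon>. (1 + \<epsilon> * q) powr \<alpha> * (1 + \<epsilon> * t) - (1 + \<epsilon> * F) powr (\<alpha> + 1))"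
    have "(\<phi> has_real_derivative \<alpha> * q + t - (\<alpha> + 1) * F) (at 0)"
      unfolding \<phi>_def by (auto intro!: derivative_eq_intros)
    then have "\<exists>d>0. \<forall>h>0. h < d \<longrightarrow> \<phi> 0 < \<phi> (0 + h)"
      using False cases by (intro DERIV_pos_inc_right) auto
    then show ?thesis using that by (auto simp: \<phi>_def less_imp_le)
  qed
  show ?thesis
    by (rule exI[of _ "min d (1 / B)"]) (use d B pos in auto)
qed

lemma J_zero_ext_ge:
  assumes \<alpha>: "\<alpha> > 0" and v: "continuous_on {-1/2..1/2} v"
    and nonneg: "\<And>x. x \<in> {-1/2..1/2} \<Longrightarrow> v x \<ge> 0" and mass: "integral {-1/2..1/2} v > 0"
    and a: "a \<ge> 0" "ennreal a \<le> Linf_norm (\<lambda>\<xi>. of_real \<xi> * fourier (zero_ext v) \<xi>)"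
    and b: "((\<lambda>x. \<bar>x\<bar> powr \<alpha> * v x) has_integral b) {-1/2..1/2}"
  shows "ennreal (a powr \<alpha> * b / integral {-1/2..1/2} v powr (\<alpha> + 1)) \<le> J \<alpha> (zero_ext v)"
proof -
  have eq: "(\<lambda>x. \<bar>x\<bar> powr \<alpha> * zero_ext v x) = zero_ext (\<lambda>x. \<bar>x\<bar> powr \<alpha> * v x)"
    by (auto simp: zero_ext_def fun_eq_iff)
  have cont: "continuous_on {-1/2..1/2} (\<lambda>x::real. \<bar>x\<bar> powr \<alpha> * v x)"
    by (intro continuous_intros continuous_on_powr' v) (use \<alpha> in auto)
  have b0: "b \<ge> 0" by (rule has_integral_nonneg[OF b]) (use nonneg in auto)
  have weight: "L1_norm (\<lambda>x. \<bar>x\<bar> powr \<alpha> * zero_ext v x) = ennreal b"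
    unfolding eq by (subst L1_norm_zero_ext[OF cont]) (use nonneg b in \<open>auto simp: integral_unique\<close>)
  have total: "L1_norm (zero_ext v) = ennreal (integral {-1/2..1/2} v)"
    by (rule L1_norm_zero_ext[OF v]) (rule nonneg)
  have "ennreal (a powr \<alpha> * b / integral {-1/2..1/2} v powr (\<alpha> + 1))
      = ennreal (a powr \<alpha>) * ennreal b / ennreal (integral {-1/2..1/2} v powr (\<alpha> + 1))"
    unfolding ennreal_mult[OF powr_ge_zero b0, symmetric]
    by (subst divide_ennreal) (use mass b0 in auto)
  also have "\<dots> \<le> ennreal_powr (Linf_norm (\<lambda>\<xi>. of_real \<xi> * fourier (zero_ext v) \<xi>)) \<alpha> * ennreal b
      / ennreal (integral {-1/2..1/2} v powr (\<alpha> + 1))"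
    using ennreal_powr_mono[OF a(2) \<alpha>] a(1)
    by (intro divide_right_mono_ennreal mult_right_mono) (simp_all add: ennreal_powr_ennreal)
  also have "\<dots> = J \<alpha> (zero_ext v)"
    unfolding J_def weight total using mass by (simp add: ennreal_powr_ennreal)
  finally show ?thesis .
qed

lemma smooth_within_imp_continuous_on:
  assumes "smooth_within S f"
  shows "continuous_on S f"
proof -
  obtain D where D0: "\<forall>x\<in>S. D 0 x = f x"
    and D: "\<forall>n. \<forall>x\<in>S. (D n has_real_derivative D (Suc n) x) (at x within S)"
    using assms unfolding smooth_within_def by blast
  have "continuous_on S (D 0)" by (rule DERIV_continuous_on) (use D in blast)
  then show ?thesis using D0 by (simp cong: continuous_on_cong)
qed

lemma cos_mode_eq_frequency: "(\<lambda>x. cos (2 * pi * (real k + 1/2) * x)) = cos_mode k"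
  by (simp add: cos_mode_def fun_eq_iff algebra_simps)

text \<open>The two halves of the maximum collect the signed weighted modes of even and of odd index, and by the
dichotomy at least one of them reaches the required value.\<close>

lemma max_fourier_ge:
  assumes \<alpha>: "\<alpha> > 0" and alt: "\<And>k. (-1) ^ k * L2_inner (cap \<alpha>) (cos_mode k) > 0"
    and f: "continuous_on {-1/2..1/2} f"
  shows "max_fourier f \<ge>
    ereal ((\<alpha> + 1) / (\<alpha> * pi) * (LINT x:{-1/2..1/2}|lborel. (1 - \<bar>2 * x\<bar> powr \<alpha>) * f x))"
proof -
  have "continuous_on {-1/2..1/2} (\<lambda>x. (1 - \<bar>2 * x\<bar> powr \<alpha>) * f x)"
    by (intro continuous_intros continuous_on_powr' f) (use \<alpha> in auto)
  from set_borel_integral_eq_integral(2)[OF set_integrable_continuous_Icc[OF this]]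
  have cap: "(LINT x:{-1/2..1/2}|lborel. (1 - \<bar>2 * x\<bar> powr \<alpha>) * f x) = L2_inner (cap \<alpha>) f"
    by (simp add: L2_inner_def cap_def)
  define m where "m = (\<lambda>k. (-1) ^ k * (real k + 1/2) * L2_inner f (cos_mode k))"
  have "\<exists>k. (\<alpha> + 1) / \<alpha> * L2_inner (cap \<alpha>) f \<le> pi * m k"
    using mode_dichotomy[OF \<alpha> alt f] unfolding m_def by (metis less_imp_le order_refl)
  then obtain k where "(\<alpha> + 1) / \<alpha> * L2_inner (cap \<alpha>) f \<le> pi * m k" by blast
  then have le: "(\<alpha> + 1) / (\<alpha> * pi) * L2_inner (cap \<alpha>) f \<le> m k"
    using \<alpha> by (simp add: field_simps)
  have m: "m k = (-1) ^ k * ((real k + 1/2) * Re (fourier (zero_ext f) (real k + 1/2)))"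
    by (simp add: m_def Re_fourier_zero_ext[OF f] cos_mode_eq_frequency)
  have "ereal (m k) \<le> max_fourier f"
  proof (cases "even k")
    case True
    then obtain j where "k = 2 * j" by (elim evenE)
    then have "real k + 1/2 = 2 * real j + 1/2" by simp
    then have "m k = (2 * real j + 1/2) * Re (fourier (zero_ext f) (2 * real j + 1/2))"
      using True by (simp add: m)
    then have "ereal (m k) \<le> (SUP j::nat. ereal ((2 * real j + 1/2) * Re (fourier (zero_ext f) (2 * real j + 1/2))))"
      by (simp only:) (rule SUP_upper, simp)
    then show ?thesis unfolding max_fourier_def by (simp only: le_max_iff_disj) blast
  next
    case False
    then obtain j where k: "k = 2 * j + 1" by (elim oddE)
    have "real k + 1/2 = 2 * real j + 3/2" by (simp add: k)
    then have "ereal (m k) = - ereal ((2 * real j + 3/2) * Re (fourier (zero_ext f) (2 * real j + 3/2)))"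
      using False by (simp add: m)
    also have "\<dots> \<le> - (INF j::nat. ereal ((2 * real j + 3/2) * Re (fourier (zero_ext f) (2 * real j + 3/2))))"
      unfolding ereal_minus_le_minus by (rule INF_lower) simp
    finally show ?thesis unfolding max_fourier_def by (simp only: le_max_iff_disj) blast
  qed
  with le show ?thesis unfolding cap by (meson ereal_less_eq(3) order_trans)
qed

text \<open>Write \<open>F\<close> and \<open>G\<close> for the integrals of \<open>f\<close> and of \<open>\<bar>2 * x\<bar> powr \<alpha> * f x\<close>. For the perturbed
function the sup norm in the numerator is at least \<open>(1 + \<epsilon> * q) / pi\<close> with \<open>q = pi * m k\<close>, for
every \<open>k\<close>, the weighted integral is proportional to \<open>1 + \<epsilon> * t\<close>, and the mass is \<open>1 + \<epsilon> * F\<close>.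
Since \<open>\<alpha> * s + t = (\<alpha> + 1) * F\<close>, an index with \<open>q > s\<close> gives a strict first-order gain; if there is
none, then \<open>q\<close>, \<open>s\<close>, \<open>F\<close> and hence \<open>t\<close> coincide.\<close>

lemma J_local_min:
  assumes \<alpha>: "\<alpha> > 0" and alt: "\<And>k. (-1) ^ k * L2_inner (cap \<alpha>) (cos_mode k) > 0"
    and f: "continuous_on {-1/2..1/2} f"
  shows "\<exists>\<epsilon>0>0. \<forall>\<epsilon>. 0 < \<epsilon> \<and> \<epsilon> < \<epsilon>0 \<longrightarrow>
     J \<alpha> (\<lambda>x. indicator {-1/2..1/2} x + \<epsilon> * zero_ext f x) \<ge> J \<alpha> (indicator {-1/2..1/2})"
proof -
  define m where "m = (\<lambda>k. (-1) ^ k * (real k + 1/2) * L2_inner f (cos_mode k))"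
  define F where "F = integral {-1/2..1/2} f"
  define G where "G = L2_inner (\<lambda>x. \<bar>2 * x\<bar> powr \<alpha>) f"
  define s where "s = (\<alpha> + 1) / \<alpha> * L2_inner (cap \<alpha>) f"
  define t where "t = (\<alpha> + 1) * G"
  have cw: "continuous_on {-1/2..1/2} (\<lambda>x::real. \<bar>2 * x\<bar> powr \<alpha>)"
    by (intro continuous_intros continuous_on_powr') (use \<alpha> in auto)
  have F: "(f has_integral F) {-1/2..1/2}"
    unfolding F_def by (intro integrable_integral integrable_continuous_real f)
  have G: "((\<lambda>x. \<bar>2 * x\<bar> powr \<alpha> * f x) has_integral G) {-1/2..1/2}"
    unfolding G_def by (intro L2_inner_has_integral cw f)
  have "((\<lambda>x. cap \<alpha> x * f x) has_integral F - G) {-1/2..1/2}"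
    using has_integral_diff[OF F G] by (simp add: cap_def algebra_simps)
  then have "L2_inner (cap \<alpha>) f = F - G" by (simp add: L2_inner_def integral_unique)
  then have "\<alpha> * s = (\<alpha> + 1) * (F - G)" using \<alpha> by (simp add: s_def)
  then have st: "\<alpha> * s + t = (\<alpha> + 1) * F" by (simp add: t_def algebra_simps)
  obtain k where k: "\<alpha> * (pi * m k) + t > (\<alpha> + 1) * F \<or> (pi * m k = F \<and> t = F)"
  proof -
    consider k where "pi * m k > s" | "pi * m 0 = s" "F = s"
      using mode_dichotomy[OF \<alpha> alt f] unfolding m_def s_def F_def by metis
    then show ?thesis
    proof cases
      case (1 k)
      then have "\<alpha> * (pi * m k) > \<alpha> * s" using \<alpha> by (simp only: mult_less_cancel_left_pos)
      then have "\<alpha> * (pi * m k) + t > (\<alpha> + 1) * F" unfolding st[symmetric] by (rule add_strict_right_mono)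
      then show ?thesis using that[of k] by blast
    next
      case 2
      have "\<alpha> * F + t = \<alpha> * F + F"
        using st unfolding 2(2)[symmetric] distrib_right mult_1 .
      then have "t = F" by (rule add_left_imp_eq)
      moreover have "pi * m 0 = F" using 2 by (rule trans[OF _ sym])
      ultimately show ?thesis using that[of 0] by blast
    qed
  qed
  define q where "q = pi * m k"
  obtain \<epsilon>1 where \<epsilon>1: "\<epsilon>1 > 0" "\<And>\<epsilon>. 0 < \<epsilon> \<Longrightarrow> \<epsilon> < \<epsilon>1 \<Longrightarrow> 1 + \<epsilon> * q > 0 \<and> 1 + \<epsilon> * t > 0 \<and> 1 + \<epsilon> * F > 0 \<and>
      (1 + \<epsilon> * F) powr (\<alpha> + 1) \<le> (1 + \<epsilon> * q) powr \<alpha> * (1 + \<epsilon> * t)"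
    using first_order_comparison[OF \<alpha> k] unfolding q_def by blast
  obtain B where "\<And>x. x \<in> {-1/2..1/2} \<Longrightarrow> \<bar>f x\<bar> \<le> B"
    using continuous_on_Icc_obtain_bound[OF f] by blast
  then have B: "\<bar>f x\<bar> \<le> \<bar>B\<bar> + 1" if "x \<in> {-1/2..1/2}" for x using that by force
  define K where "K = (1 / pi) powr \<alpha> * ((1 / 2) powr \<alpha> / (\<alpha> + 1))"
  have "J \<alpha> (\<lambda>x. indicator {-1/2..1/2} x + \<epsilon> * zero_ext f x) \<ge> J \<alpha> (indicator {-1/2..1/2})"
    if \<epsilon>: "0 < \<epsilon>" "\<epsilon> < min \<epsilon>1 (1 / (\<bar>B\<bar> + 1))" for \<epsilon>
  proof -
    define v where "v = (\<lambda>x. 1 + \<epsilon> * f x)"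
    have v_eq: "(\<lambda>x. indicator {-1/2..1/2} x + \<epsilon> * zero_ext f x) = zero_ext v"
      by (auto simp: zero_ext_def v_def fun_eq_iff)
    have v: "continuous_on {-1/2..1/2} v" unfolding v_def by (intro continuous_intros f)
    have v_nonneg: "v x \<ge> 0" if x: "x \<in> {-1/2..1/2}" for x
    proof -
      have "\<bar>\<epsilon> * f x\<bar> \<le> \<epsilon> * (\<bar>B\<bar> + 1)" using B[OF x] \<epsilon> by (simp add: abs_mult)
      also have "\<dots> < 1" using \<epsilon> by (simp add: field_simps)
      finally show ?thesis unfolding v_def by linarith
    qed
    have e: "1 + \<epsilon> * q > 0" "1 + \<epsilon> * t > 0" "1 + \<epsilon> * F > 0"
      "(1 + \<epsilon> * F) powr (\<alpha> + 1) \<le> (1 + \<epsilon> * q) powr \<alpha> * (1 + \<epsilon> * t)"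
      using \<epsilon>1(2)[of \<epsilon>] \<epsilon> by auto
    have "(v has_integral 1 + \<epsilon> * F) {-1/2..1/2}"
      unfolding v_def
      using has_integral_add[OF has_integral_const_real[of "1::real" "-1/2" "1/2"] has_integral_mult_right[OF F, of \<epsilon>]]
      by simp
    then have mass: "integral {-1/2..1/2} v = 1 + \<epsilon> * F" by (rule integral_unique)
    have "L2_inner v (cos_mode k) = L2_inner (cos_mode k) (\<lambda>_. 1) + \<epsilon> * L2_inner f (cos_mode k)"
      unfolding v_def L2_inner_commute[of "cos_mode k"]
      using L2_inner_add_left[of "\<lambda>_. 1" "\<lambda>x. \<epsilon> * f x" "cos_mode k"] f
      by (simp add: L2_inner_scale_left continuous_on_mult_left continuous_on_cos_mode)
    then have "(real k + 1/2) * L2_inner v (cos_mode k)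
        = (real k + 1/2) * ((-1) ^ k / (pi * (real k + 1/2))) + \<epsilon> * ((real k + 1/2) * L2_inner f (cos_mode k))"
      unfolding L2_inner_cos_mode_one by (simp only: distrib_left mult_ac)
    also have "(real k + 1/2) * ((-1) ^ k / (pi * (real k + 1/2))) = (-1) ^ k / pi"
      by (simp add: add_nonneg_pos)
    finally have "(-1) ^ k * ((real k + 1/2) * L2_inner v (cos_mode k))
        = ((-1) ^ k * (-1) ^ k) / pi + \<epsilon> * m k"
      by (simp add: m_def distrib_left mult_ac)
    also have "(-1::real) ^ k * (-1) ^ k = 1" by (simp add: power_mult_distrib[symmetric])
    also have "1 / pi + \<epsilon> * m k = (1 + \<epsilon> * q) / pi" by (simp add: q_def add_divide_distrib)
    finally have "\<bar>(real k + 1/2) * L2_inner v (cos_mode k)\<bar> = \<bar>(1 + \<epsilon> * q) / pi\<bar>"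
      using abs_mult[of "(-1) ^ k" "(real k + 1/2) * L2_inner v (cos_mode k)"] by (simp only: power_abs) simp
    then have sup_bound: "ennreal ((1 + \<epsilon> * q) / pi) \<le> Linf_norm (\<lambda>\<xi>. of_real \<xi> * fourier (zero_ext v) \<xi>)"
      using Linf_norm_ge_Re[OF v, of "real k + 1/2"] e(1) unfolding cos_mode_eq_frequency by simp
    have weight: "((\<lambda>x. \<bar>x\<bar> powr \<alpha> * v x) has_integral (1 / 2) powr \<alpha> / (\<alpha> + 1) * (1 + \<epsilon> * t)) {-1/2..1/2}"
    proof -
      have "((\<lambda>x. (1 / 2) powr \<alpha> * (\<bar>2 * x\<bar> powr \<alpha> + \<epsilon> * (\<bar>2 * x\<bar> powr \<alpha> * f x)))
          has_integral (1 / 2) powr \<alpha> * (1 / (\<alpha> + 1) + \<epsilon> * G)) {-1/2..1/2}"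
        by (intro has_integral_mult_right has_integral_add has_integral_abs_double_powr \<alpha> G)
      moreover have "(1 / 2) powr \<alpha> * (\<bar>2 * x\<bar> powr \<alpha> + \<epsilon> * (\<bar>2 * x\<bar> powr \<alpha> * f x)) = \<bar>x\<bar> powr \<alpha> * v x" for x
        unfolding v_def abs_powr_eq_abs_double_powr[of x] by (simp only: distrib_left distrib_right mult_ac mult_1_right mult_1)
      moreover have "(1 / 2) powr \<alpha> * (1 / (\<alpha> + 1) + \<epsilon> * G) = (1 / 2) powr \<alpha> / (\<alpha> + 1) * (1 + \<epsilon> * t)"
        using \<alpha> by (simp add: t_def field_simps)
      ultimately show ?thesis by (simp only:)
    qed
    have "ennreal (((1 + \<epsilon> * q) / pi) powr \<alpha> * ((1 / 2) powr \<alpha> / (\<alpha> + 1) * (1 + \<epsilon> * t))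
        / (1 + \<epsilon> * F) powr (\<alpha> + 1)) \<le> J \<alpha> (zero_ext v)"
      unfolding mass[symmetric]
      by (rule J_zero_ext_ge[OF \<alpha> v v_nonneg _ _ sup_bound weight]) (use e mass in auto)
    moreover have "((1 + \<epsilon> * q) / pi) powr \<alpha> * ((1 / 2) powr \<alpha> / (\<alpha> + 1) * (1 + \<epsilon> * t))
        / (1 + \<epsilon> * F) powr (\<alpha> + 1)
      = K * ((1 + \<epsilon> * q) powr \<alpha> * (1 + \<epsilon> * t) / (1 + \<epsilon> * F) powr (\<alpha> + 1))"
      using e by (simp add: K_def powr_divide)
    moreover have "K * 1 \<le> K * ((1 + \<epsilon> * q) powr \<alpha> * (1 + \<epsilon> * t) / (1 + \<epsilon> * F) powr (\<alpha> + 1))"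
      using e \<alpha> by (intro mult_left_mono) (auto simp: K_def)
    ultimately have "ennreal K \<le> J \<alpha> (zero_ext v)"
      by (metis (no_types, lifting) ennreal_leI mult_1_right order_trans)
    then show ?thesis unfolding v_eq using J_indicator_le[OF \<alpha>] unfolding K_def by (rule order_trans[rotated])
  qed
  then show ?thesis
    by (intro exI[of _ "min \<epsilon>1 (1 / (\<bar>B\<bar> + 1))"]) (use \<epsilon>1(1) in auto)
qed

theorem mainTheorem4:
  fixes \<alpha> :: real
  assumes "\<alpha> > 0"
    and "\<And>k::nat. k \<ge> 1 \<Longrightarrow> odd k \<Longrightarrow> coeff_a \<alpha> k \<ge> 0"
    and "\<And>k::nat. k \<ge> 1 \<Longrightarrow> even k \<Longrightarrow> coeff_a \<alpha> k \<le> 0"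
  shows
    "(\<forall>f :: real \<Rightarrow> real.
        smooth_within {-1/2..1/2} f \<longrightarrow> (\<forall>x\<in>{-1/2..1/2}. f (- x) = f x) \<longrightarrow>
        max_fourier f \<ge>
          ereal ((\<alpha> + 1) / (\<alpha> * pi) *
            (LINT x:{-1/2..1/2}|lborel. (1 - \<bar>2 * x\<bar> powr \<alpha>) * f x)))
     \<and>
     (\<forall>f :: real \<Rightarrow> real.
        smooth_within {-1/2..1/2} f \<longrightarrow>
        (\<exists>\<epsilon>\<^sub>0>0. \<forall>\<epsilon>. 0 < \<epsilon> \<and> \<epsilon> < \<epsilon>\<^sub>0 \<longrightarrow>
           J \<alpha> (\<lambda>x. indicator {-1/2..1/2} x + \<epsilon> * zero_ext f x)
             \<ge> J \<alpha> (indicator {-1/2..1/2})))"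
proof -
  have "(-1) ^ k * L2_inner (cap \<alpha>) (cos_mode k) \<ge> 0" for k
  proof -
    have "coeff_a \<alpha> (Suc k) = (1 + \<alpha>) / \<alpha> * L2_inner (cap \<alpha>) (cos_mode k)"
      using coeff_a_eq_integral[OF assms(1)] L2_inner_cap_cos_mode[OF assms(1)] by simp
    moreover have "(-1) ^ k * coeff_a \<alpha> (Suc k) \<ge> 0"
      using assms(2)[of "Suc k"] assms(3)[of "Suc k"] by (cases "even k") auto
    ultimately have "(1 + \<alpha>) / \<alpha> * ((-1) ^ k * L2_inner (cap \<alpha>) (cos_mode k)) \<ge> 0"
      by (simp add: mult_ac)
    moreover have "(1 + \<alpha>) / \<alpha> > 0" using assms(1) by simp
    ultimately show ?thesis by (simp only: zero_le_mult_iff) auto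
  qed
  then have "\<alpha> \<ge> 2" by (rule cap_coeff_alternating_imp_ge_2[OF assms(1)])
  then have alt: "(-1) ^ k * L2_inner (cap \<alpha>) (cos_mode k) > 0" for k
    by (rule cap_coeff_strictly_alternating)
  show ?thesis
    using max_fourier_ge[OF assms(1) alt] J_local_min[OF assms(1) alt]
      smooth_within_imp_continuous_on by blast
qed

end
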